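(* Let $\underline\lambda=(\lambda^{(1)},\dots,\lambda^{(r)})$ be an $r$-partition with $n$ boxes, and let $\{n_T\}$ and $\{v_T\}$ ($T\in\mathrm{SYT}(\underline\lambda)$) be the natural and seminormal bases of the $\mathbb{G}_{r,n}$-module $\mathbb{G}_{r,n}^{\underline\lambda}$. For every $T\in\mathrm{SYT}(\underline\lambda)$, $$n_T=\sum_{S\le T}\underline A_{S,T}\,v_S,\qquad\text{with coefficients}\qquad\underline A_{S,T}=\prod_{i=1}^rA_{S^{(i)},T^{(i)}},$$ where the sum is over standard $r$-tableaux $S\le T$ in Bruhat order which have the same alphabet as $T$, and $A_{S^{(i)},T^{(i)}}$ is the symmetric group change-of-basis coefficient from the natural to the seminormal basis for the shape $\lambda^{(i)}$.
   Context: Tableaux. An $r$-partition of $n$ is an $r$-tuple $\underline\lambda=(\lambda^{(1)},\dots,\lambda^{(r)})$ of (possibly empty) partitions with $|\lambda^{(1)}|+\cdots+|\lambda^{(r)}|=n$; put $n_i=|\lambda^{(i)}|$. An $r$-tableau of shape $\underline\lambda$ is a filling $T=(T^{(1)},\dots,T^{(r)})$ of its boxes by $1,\dots,n$, each used once; it is standard if in each component the entries increase left to right in rows and top to bottom in columns. $\mathrm{SYT}(\underline\lambda)$ is the set of standard $r$-tableaux. $\sigma\in\mathbb{S}_n$ acts by replacing each entry $k$ by $\sigma(k)$; $s_i=(i,i+1)$. The column reading tableau $C$ is obtained by entering $1,\dots,n$ consecutively down the columns, beginning with the leftmost component and filling columns (and then components) from left to right. $w_T\in\mathbb{S}_n$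 is the unique permutation with $w_T(C)=T$. Bruhat order: $S\le T$ iff $w_S\le w_T$ in strong Bruhat order on $\mathbb{S}_n$. The alphabet of $T$ is the ordered set partition of $\{1,\dots,n\}$ whose $i$-th block is the set of entries of $T^{(i)}$. Module. $\mathbb{G}_{r,n}=\mathbb{Z}_r\wr\mathbb{S}_n$ is generated by $s_0,\dots,s_{n-1}$ with relations $s_is_j=s_js_i$ ($|i-j|>1$), $s_is_{i+1}s_i=s_{i+1}s_is_{i+1}$ ($1\le i\le n-2$), $s_0s_1s_0s_1=s_1s_0s_1s_0$, $s_i^2=1$ ($1\le i\le n-1$), $s_0^r=1$; it contains $\mathbb{S}_n=\langle s_1,\dots,s_{n-1}\rangle$. Let $\xi$ be a primitive $r$-th root of unity. The content of a box in row $x$ (counted downward) and column $y$ of its component is $y-x$; $T(i)$ is the box of $T$ containing $i$, and $a_i(T)=\dfrac{1}{ct(T(i+1))-ct(T(i))}$ when $i,i+1$ are in the same component. $\mathbb{G}_{r,n}^{\underline\lambda}$ has $\mathbb{C}$-basis $\{v_T\mid T\in\mathrm{SYT}(\underline\lambda)\}$ (the seminormal basis) with action $s_0v_T=\xi^{k-1}v_T$ if $1$ is in the $k$-th component of $T$; and for $1\le i\le n-1$, $s_iv_T=v_{s_i(T)}$ if $i,i+1$ are in different components of $T$, and $s_iv_T=a_i(T)v_T+(1+a_i(T))v_{s_i(T)}$ if they are in the same component, with $v_{s_i(T)}=0$ if $s_i(T)$ is nonstandard. The natural basis is $\{n_T\mid T\in\mathrm{SYT}(\underline\lambda)\}$ with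 $n_T:=w_Tv_C$. Symmetric group coefficients. For a partition $\lambda$ of $m$ and standard tableaux $P,Q$ of shape $\lambda$ (with entries $1,\dots,m$), $A_{P,Q}$ is defined by $n_Q=\sum_PA_{P,Q}v_P$ in $\mathbb{S}_m^\lambda$, where $\mathbb{S}_m^\lambda$ has seminormal basis $\{v_P\mid P\in\mathrm{SYT}(\lambda)\}$ with action $s_iv_P=a_i(P)v_P+(1+a_i(P))v_{s_i(P)}$ ($v_{s_i(P)}=0$ if nonstandard), and $n_Q=w_Qv_{C_\lambda}$, with $C_\lambda$ the column reading tableau of shape $\lambda$ and $w_Q\in\mathbb{S}_m$ such that $w_Q(C_\lambda)=Q$. For $\lambda=\emptyset$ the coefficient is $1$. When $S$ and $T$ have the same alphabet, $A_{S^{(i)},T^{(i)}}$ is computed after relabeling the entries of $S^{(i)}$ and $T^{(i)}$ by the order-preserving bijection from the common set of entries to $\{1,\dots,n_i\}$. *)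

theory Defs
  imports Complex_Main "HOL-Library.Function_Algebras" "HOL-Algebra.Sym_Groups"
begin

section \<open>Multipartitions and tableaux\<close>

definition is_partition :: "nat list \<Rightarrow> bool" where
  "is_partition p \<longleftrightarrow> sorted_wrt (\<ge>) p \<and> 0 \<notin> set p"

definition rsize :: "nat list list \<Rightarrow> nat" where
  "rsize lam = sum_list (map sum_list lam)"

definition rpartition :: "nat \<Rightarrow> nat \<Rightarrow> nat list list \<Rightarrow> bool" where
  "rpartition r n lam \<longleftrightarrow> length lam = r \<and> (\<forall>p \<in> set lam. is_partition p) \<and> rsize lam = n"

text \<open>A box is a triple (component, row, column), all three counted from 0.  A tableau is a function
  on boxes that takes the value 0 outside its shape, so that a tableau is determined by its filling
  and permutations of \<open>{1..n}\<close> (which fix 0) act by composition.  A single partition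
  \<open>p\<close> is treated as the 1-partition \<open>[p]\<close>.\<close>

type_synonym box = "nat \<times> nat \<times> nat"
type_synonym tableau = "box \<Rightarrow> nat"

definition boxes :: "nat list list \<Rightarrow> box set" where
  "boxes lam = {(k, x, y). k < length lam \<and> x < length (lam ! k) \<and> y < lam ! k ! x}"

definition is_tableau :: "nat list list \<Rightarrow> tableau \<Rightarrow> bool" where
  "is_tableau lam T \<longleftrightarrow> bij_betw T (boxes lam) {1..rsize lam} \<and> (\<forall>b. b \<notin> boxes lam \<longrightarrow> T b = 0)"

definition standard :: "nat list list \<Rightarrow> tableau \<Rightarrow> bool" where
  "standard lam T \<longleftrightarrow>
     (\<forall>k x y y'. (k, x, y) \<in> boxes lam \<and> (k, x, y') \<in> boxes lam \<and> y < y' \<longrightarrow> T (k, x, y) < T (k, x, y')) \<and>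
     (\<forall>k x x' y. (k, x, y) \<in> boxes lam \<and> (k, x', y) \<in> boxes lam \<and> x < x' \<longrightarrow> T (k, x, y) < T (k, x', y))"

definition SYT :: "nat list list \<Rightarrow> tableau set" where
  "SYT lam = {T. is_tableau lam T \<and> standard lam T}"

definition tab_act :: "(nat \<Rightarrow> nat) \<Rightarrow> tableau \<Rightarrow> tableau" where
  "tab_act \<sigma> T = \<sigma> \<circ> T"

definition adj :: "nat \<Rightarrow> nat \<Rightarrow> nat" where
  "adj i = Transposition.transpose i (Suc i)"

text \<open>The entry of a box is its position in the order by component, then column, then row.\<close>

definition column_reading :: "nat list list \<Rightarrow> tableau" where
  "column_reading lam = (\<lambda>(k, x, y). if (k, x, y) \<in> boxes lam
     then card {(k', x', y') \<in> boxes lam. k' < k \<or> (k' = k \<and> (y' < y \<or> (y' = y \<and> x' \<le> x)))}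
     else 0)"

definition tab_perm :: "nat list list \<Rightarrow> tableau \<Rightarrow> nat \<Rightarrow> nat" where
  "tab_perm lam T =
     (THE w. w permutes {1..rsize lam} \<and> tab_act w (column_reading lam) = T)"

definition box_of :: "tableau \<Rightarrow> nat \<Rightarrow> box" where
  "box_of T i = (THE b. T b = i)"

definition comp_of :: "tableau \<Rightarrow> nat \<Rightarrow> nat" where
  "comp_of T i = fst (box_of T i)"

definition content :: "box \<Rightarrow> int" where
  "content = (\<lambda>(k, x, y). int y - int x)"

definition a_coeff :: "tableau \<Rightarrow> nat \<Rightarrow> complex" where
  "a_coeff T i = 1 / of_int (content (box_of T (Suc i)) - content (box_of T i))"

definition entries :: "nat list list \<Rightarrow> tableau \<Rightarrow> nat \<Rightarrow> nat set" where
  "entries lam T k = T ` {b \<in> boxes lam. fst b = k}"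

definition alphabet :: "nat list list \<Rightarrow> tableau \<Rightarrow> nat set list" where
  "alphabet lam T = map (entries lam T) [0..<length lam]"

text \<open>On a finite set \<open>E\<close>, the map \<open>rank E\<close> is the order-preserving bijection onto
  \<open>{1..card E}\<close>.  Values outside the shape remain 0, because 0 is never an entry.\<close>

definition rank :: "nat set \<Rightarrow> nat \<Rightarrow> nat" where
  "rank E e = card {e' \<in> E. e' \<le> e}"

definition component :: "nat list list \<Rightarrow> tableau \<Rightarrow> nat \<Rightarrow> tableau" where
  "component lam T i =
     (\<lambda>(k, x, y). if k = 0 then rank (entries lam T i) (T (i, x, y)) else 0)"

section \<open>Strong Bruhat order\<close>

definition perm_length :: "nat \<Rightarrow> (nat \<Rightarrow> nat) \<Rightarrow> nat" where
  "perm_length n w = card {(i, j). 1 \<le> i \<and> i < j \<and> j \<le> n \<and> w j < w i}"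

definition bruhat_step :: "nat \<Rightarrow> (nat \<Rightarrow> nat) \<Rightarrow> (nat \<Rightarrow> nat) \<Rightarrow> bool" where
  "bruhat_step n u w \<longleftrightarrow>
     (\<exists>a \<in> {1..n}. \<exists>b \<in> {1..n}. a \<noteq> b \<and> w = u \<circ> Transposition.transpose a b) \<and>
     perm_length n u < perm_length n w"

definition bruhat_le :: "nat \<Rightarrow> (nat \<Rightarrow> nat) \<Rightarrow> (nat \<Rightarrow> nat) \<Rightarrow> bool" where
  "bruhat_le n = (bruhat_step n)\<^sup>*\<^sup>*"

definition tab_le :: "nat list list \<Rightarrow> tableau \<Rightarrow> tableau \<Rightarrow> bool" where
  "tab_le lam S T \<longleftrightarrow> bruhat_le (rsize lam) (tab_perm lam S) (tab_perm lam T)"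

section \<open>The group and its representations\<close>

text \<open>The pair \<open>(f, \<sigma>)\<close> is the monomial transformation sending the \<open>k\<close>-th standard basis vector
  to \<open>\<xi> ^ f (\<sigma> k)\<close> times the \<open>\<sigma> k\<close>-th one.\<close>

definition wreath :: "nat \<Rightarrow> nat \<Rightarrow> ((nat \<Rightarrow> nat) \<times> (nat \<Rightarrow> nat)) monoid" where
  "wreath r n = \<lparr>
     carrier = {(f, \<sigma>). (\<forall>k \<in> {1..n}. f k < r) \<and> (\<forall>k. k \<notin> {1..n} \<longrightarrow> f k = 0) \<and> \<sigma> permutes {1..n}},
     mult = (\<lambda>(f, \<sigma>) (g, \<tau>). (\<lambda>k. (f k + g (Hilbert_Choice.inv \<sigma> k)) mod r, \<sigma> \<circ> \<tau>)),
     one = (\<lambda>k. 0, id) \<rparr>"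

definition wreath_s0 :: "nat \<Rightarrow> (nat \<Rightarrow> nat) \<times> (nat \<Rightarrow> nat)" where
  "wreath_s0 r = (\<lambda>k. if k = 1 then 1 mod r else 0, id)"

definition wreath_perm :: "(nat \<Rightarrow> nat) \<Rightarrow> (nat \<Rightarrow> nat) \<times> (nat \<Rightarrow> nat)" where
  "wreath_perm \<sigma> = (\<lambda>k. 0, \<sigma>)"

definition primitive_root_of_unity :: "nat \<Rightarrow> complex \<Rightarrow> bool" where
  "primitive_root_of_unity r \<xi> \<longleftrightarrow> 0 < r \<and> \<xi> ^ r = 1 \<and> (\<forall>k. 0 < k \<and> k < r \<longrightarrow> \<xi> ^ k \<noteq> 1)"

definition cscale :: "complex \<Rightarrow> ('t \<Rightarrow> complex) \<Rightarrow> 't \<Rightarrow> complex" where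
  "cscale c f = (\<lambda>t. c * f t)"

text \<open>Linear representations of \<open>G\<close> on a subspace \<open>V\<close> of a space of complex-valued
  functions; nothing is required of \<open>\<rho> g\<close> off \<open>V\<close>.\<close>

definition linear_rep ::
  "('g, 'm) monoid_scheme \<Rightarrow> ('t \<Rightarrow> complex) set \<Rightarrow> ('g \<Rightarrow> ('t \<Rightarrow> complex) \<Rightarrow> ('t \<Rightarrow> complex)) \<Rightarrow> bool"
  where
  "linear_rep G V \<rho> \<longleftrightarrow>
     (\<forall>g \<in> carrier G. \<forall>f \<in> V. \<rho> g f \<in> V) \<and>
     (\<forall>g \<in> carrier G. \<forall>f \<in> V. \<forall>h \<in> V. \<rho> g (f + h) = \<rho> g f + \<rho> g h) \<and>
     (\<forall>g \<in> carrier G. \<forall>f \<in> V. \<forall>c. \<rho> g (cscale c f) = cscale c (\<rho> g f)) \<and>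
     (\<forall>f \<in> V. \<rho> \<one>\<^bsub>G\<^esub> f = f) \<and>
     (\<forall>g \<in> carrier G. \<forall>h \<in> carrier G. \<forall>f \<in> V. \<rho> (g \<otimes>\<^bsub>G\<^esub> h) f = \<rho> g (\<rho> h f))"

section \<open>Seminormal modules and natural bases\<close>

text \<open>The underlying space of the module is the free complex vector space on \<open>SYT lam\<close>, and
  \<open>sn_vec lam T\<close> is the basis vector of \<open>T\<close>, taken to be 0 if \<open>T\<close> is not standard.\<close>

definition sn_space :: "nat list list \<Rightarrow> (tableau \<Rightarrow> complex) set" where
  "sn_space lam = {f. \<forall>T. T \<notin> SYT lam \<longrightarrow> f T = 0}"

definition sn_vec :: "nat list list \<Rightarrow> tableau \<Rightarrow> tableau \<Rightarrow> complex" where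
  "sn_vec lam T = (\<lambda>S. if S = T \<and> T \<in> SYT lam then 1 else 0)"

text \<open>Since components are counted from 0, the eigenvalue of \<open>s\<^sub>0\<close> is \<open>\<xi> ^ k\<close> for component \<open>k\<close>.
  The action on generators determines \<open>\<rho>\<close> on \<open>sn_space lam\<close>.\<close>

definition seminormal_rep ::
  "nat \<Rightarrow> complex \<Rightarrow> nat list list \<Rightarrow>
   ((nat \<Rightarrow> nat) \<times> (nat \<Rightarrow> nat) \<Rightarrow> (tableau \<Rightarrow> complex) \<Rightarrow> (tableau \<Rightarrow> complex)) \<Rightarrow> bool" where
  "seminormal_rep r \<xi> lam \<rho> \<longleftrightarrow>
     linear_rep (wreath r (rsize lam)) (sn_space lam) \<rho> \<and>
     (\<forall>T \<in> SYT lam.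
        (1 \<le> rsize lam \<longrightarrow>
           \<rho> (wreath_s0 r) (sn_vec lam T) = cscale (\<xi> ^ comp_of T 1) (sn_vec lam T)) \<and>
        (\<forall>i. 1 \<le> i \<and> i < rsize lam \<longrightarrow>
           \<rho> (wreath_perm (adj i)) (sn_vec lam T) =
             (if comp_of T i \<noteq> comp_of T (Suc i) then sn_vec lam (tab_act (adj i) T)
              else cscale (a_coeff T i) (sn_vec lam T)
                   + cscale (1 + a_coeff T i) (sn_vec lam (tab_act (adj i) T)))))"

definition natural_vec ::
  "((nat \<Rightarrow> nat) \<times> (nat \<Rightarrow> nat) \<Rightarrow> (tableau \<Rightarrow> complex) \<Rightarrow> (tableau \<Rightarrow> complex)) \<Rightarrow>
   nat list list \<Rightarrow> tableau \<Rightarrow> tableau \<Rightarrow> complex" where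
  "natural_vec \<rho> lam T = \<rho> (wreath_perm (tab_perm lam T)) (sn_vec lam (column_reading lam))"

definition sym_seminormal_rep ::
  "nat list \<Rightarrow> ((nat \<Rightarrow> nat) \<Rightarrow> (tableau \<Rightarrow> complex) \<Rightarrow> (tableau \<Rightarrow> complex)) \<Rightarrow> bool" where
  "sym_seminormal_rep p \<rho> \<longleftrightarrow>
     linear_rep (sym_group (sum_list p)) (sn_space [p]) \<rho> \<and>
     (\<forall>P \<in> SYT [p]. \<forall>i. 1 \<le> i \<and> i < sum_list p \<longrightarrow>
        \<rho> (adj i) (sn_vec [p] P) =
          cscale (a_coeff P i) (sn_vec [p] P)
          + cscale (1 + a_coeff P i) (sn_vec [p] (tab_act (adj i) P)))"

definition sym_natural_vec ::
  "((nat \<Rightarrow> nat) \<Rightarrow> (tableau \<Rightarrow> complex) \<Rightarrow> (tableau \<Rightarrow> complex)) \<Rightarrow>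
   nat list \<Rightarrow> tableau \<Rightarrow> tableau \<Rightarrow> complex" where
  "sym_natural_vec \<rho> p Q = \<rho> (tab_perm [p] Q) (sn_vec [p] (column_reading [p]))"

text \<open>The coefficient of \<open>sn_vec [p] P\<close> in a vector of \<open>sn_space [p]\<close> is its value at \<open>P\<close>.\<close>

definition sym_coeff ::
  "((nat \<Rightarrow> nat) \<Rightarrow> (tableau \<Rightarrow> complex) \<Rightarrow> (tableau \<Rightarrow> complex)) \<Rightarrow>
   nat list \<Rightarrow> tableau \<Rightarrow> tableau \<Rightarrow> complex" where
  "sym_coeff \<rho> p P Q = sym_natural_vec \<rho> p Q P"

end

theory Submission
  imports Defs
begin

text \<open>Put \<open>d\<^sub>i(T) = a\<^sub>i(T)\<close> if \<open>i\<close> and \<open>i + 1\<close> lie in the same component of \<open>T\<close>, and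
  \<open>d\<^sub>i(T) = 0\<close> otherwise.  Then both cases of the seminormal action read
  \<open>s\<^sub>i v\<^sub>T = d\<^sub>i(T) v\<^sub>T + (1 + d\<^sub>i(T)) v\<close> with \<open>v\<close> the vector of \<open>s\<^sub>i T\<close>, and the restriction to
  \<open>\<S>\<^sub>n\<close> of the module of an r-partition and the modules of the single partitions are instances of one
  notion (\<open>seminormal_action\<close>).  Dually, the coefficient of \<open>v\<^sub>R\<close> in \<open>s\<^sub>i f\<close> is
  \<open>d\<^sub>i(R) f(R) + (1 + d\<^sub>i(s\<^sub>i R)) f(s\<^sub>i R)\<close> (\<open>act_adj_apply\<close>).

  A standard tableau \<open>T\<close> other than the column reading tableau \<open>C\<close> has some \<open>i + 1\<close> that is read
  before \<open>i\<close>.  These two entries are not forced into their order by a common row or column, so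
  \<open>S = s\<^sub>i T\<close> is standard, its permutation is shorter by one Bruhat step, and \<open>n\<^sub>T = s\<^sub>i n\<^sub>S\<close>.  Hence
  everything can be proved by climbing from \<open>C\<close>, where \<open>n\<^sub>C = v\<^sub>C\<close> (\<open>SYT_induct\<close>).

  Two facts are proved in this way.  The first (\<open>nat_vec_support\<close>) is that \<open>v\<^sub>R\<close> occurs in \<open>n\<^sub>T\<close> only if
  \<open>R \<le> T\<close>: a tableau occurring in \<open>s\<^sub>i n\<^sub>S\<close> is \<open>Q\<close> or \<open>s\<^sub>i Q\<close> with \<open>Q \<le> S\<close>, and the lifting property of the
  Bruhat order puts \<open>s\<^sub>i Q\<close> below \<open>S\<close> or below \<open>s\<^sub>i S\<close>.  The second (\<open>nat_vec_factorization\<close>) is the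
  product formula, with coefficient 0 when the alphabets differ.  If \<open>i\<close> and \<open>i + 1\<close> lie in different
  components of \<open>R\<close>, then \<open>s\<^sub>i\<close> only permutes the alphabets and leaves all relabelled components
  unchanged.  If they lie in the same component \<open>m\<close>, they are relabelled to consecutive numbers
  \<open>j, j + 1\<close>, contents do not change, and the recursion for the r-tableaux is the recursion for the
  partition \<open>\<lambda>\<^bsup>(m)\<^esup>\<close> times the unchanged factors of the other components.  The two facts together
  say which coefficients survive and what they are.\<close>

section \<open>Positions in finite totally ordered sets\<close>

text \<open>Both the column reading tableau and the relabelling of a component number the elements of a finite
  set by counting predecessors, for different total orders.\<close>

lemma position_le_iff:
  assumes "finite A"
    and refl: "\<And>x. x \<in> A \<Longrightarrow> leq x x"
    and trans: "\<And>x y z. leq x y \<Longrightarrow> leq y z \<Longrightarrow> leq x z"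
    and total: "\<And>x y. x \<in> A \<Longrightarrow> y \<in> A \<Longrightarrow> leq x y \<or> leq y x"
    and b: "b \<in> A" and c: "c \<in> A"
  shows "card {x \<in> A. leq x b} \<le> card {x \<in> A. leq x c} \<longleftrightarrow> leq b c"
proof
  assume "leq b c"
  then have "{x \<in> A. leq x b} \<subseteq> {x \<in> A. leq x c}" using trans by blast
  then show "card {x \<in> A. leq x b} \<le> card {x \<in> A. leq x c}"
    using \<open>finite A\<close> by (intro card_mono) auto
next
  assume *: "card {x \<in> A. leq x b} \<le> card {x \<in> A. leq x c}"
  show "leq b c"
  proof (rule ccontr)
    assume n: "\<not> leq b c"
    then have "leq c b" using total b c by blast
    then have "{x \<in> A. leq x c} \<subset> {x \<in> A. leq x b}"
      using trans n b refl by blast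
    then have "card {x \<in> A. leq x c} < card {x \<in> A. leq x b}"
      using \<open>finite A\<close> by (intro psubset_card_mono) auto
    with * show False by simp
  qed
qed

lemma position_bij:
  assumes "finite A"
    and refl: "\<And>x. x \<in> A \<Longrightarrow> leq x x"
    and trans: "\<And>x y z. leq x y \<Longrightarrow> leq y z \<Longrightarrow> leq x z"
    and antisym: "\<And>x y. leq x y \<Longrightarrow> leq y x \<Longrightarrow> x = y"
    and total: "\<And>x y. x \<in> A \<Longrightarrow> y \<in> A \<Longrightarrow> leq x y \<or> leq y x"
  shows "bij_betw (\<lambda>b. card {x \<in> A. leq x b}) A {1..card A}"
proof -
  let ?p = "\<lambda>b. card {x \<in> A. leq x b}"
  have inj: "inj_on ?p A"
  proof (rule inj_onI)
    fix b c assume "b \<in> A" "c \<in> A" "?p b = ?p c"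
    then have "leq b c" "leq c b"
      using position_le_iff[of A leq b c, OF assms(1-3,5)] position_le_iff[of A leq c b, OF assms(1-3,5)]
      by simp_all
    then show "b = c" by (rule antisym)
  qed
  have "?p ` A \<subseteq> {1..card A}"
  proof
    fix m assume "m \<in> ?p ` A"
    then obtain b where b: "b \<in> A" "m = ?p b" by blast
    have "?p b > 0" using b refl \<open>finite A\<close> by (auto simp: card_gt_0_iff)
    moreover have "?p b \<le> card A" using \<open>finite A\<close> by (intro card_mono) auto
    ultimately show "m \<in> {1..card A}" using b by auto
  qed
  moreover have "card (?p ` A) = card {1..card A}" using inj by (simp add: card_image)
  ultimately have "?p ` A = {1..card A}" by (intro card_subset_eq) auto
  with inj show ?thesis by (simp add: bij_betw_def)
qed

lemma rank_le_iff:
  "finite E \<Longrightarrow> e \<in> E \<Longrightarrow> e' \<in> E \<Longrightarrow> rank E e \<le> rank E e' \<longleftrightarrow> e \<le> e'"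
  unfolding rank_def by (rule position_le_iff) auto

lemma rank_less_iff:
  "finite E \<Longrightarrow> e \<in> E \<Longrightarrow> e' \<in> E \<Longrightarrow> rank E e < rank E e' \<longleftrightarrow> e < e'"
  using rank_le_iff[of E e' e] by (simp add: not_le[symmetric])

lemma rank_eq_iff:
  "finite E \<Longrightarrow> e \<in> E \<Longrightarrow> e' \<in> E \<Longrightarrow> rank E e = rank E e' \<longleftrightarrow> e = e'"
  using rank_le_iff[of E e e'] rank_le_iff[of E e' e] by auto

lemma rank_bij: "finite E \<Longrightarrow> bij_betw (rank E) E {1..card E}"
  unfolding rank_def[abs_def] by (rule position_bij) auto

lemma rank_zero: "0 \<notin> E \<Longrightarrow> rank E 0 = 0"
  unfolding rank_def by (auto intro: card_eq_0_iff[THEN iffD2])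

lemma rank_image:
  assumes "strict_mono_on E f" "e \<in> E"
  shows "rank (f ` E) (f e) = rank E e"
proof -
  have "{e' \<in> f ` E. e' \<le> f e} = f ` {e' \<in> E. e' \<le> e}"
    using assms strict_mono_on_less_eq[OF assms(1)] by auto
  moreover have "inj_on f {e' \<in> E. e' \<le> e}"
    using strict_mono_on_imp_inj_on[OF assms(1)] by (rule inj_on_subset) auto
  ultimately show ?thesis unfolding rank_def by (simp add: card_image)
qed

section \<open>Adjacent transpositions\<close>

lemma adj_simps: "adj i i = Suc i" "adj i (Suc i) = i"
  "e \<noteq> i \<Longrightarrow> e \<noteq> Suc i \<Longrightarrow> adj i e = e"
  by (simp_all add: adj_def transpose_def)

lemma adj_adj [simp]: "adj i (adj i e) = e"
  by (simp add: adj_def)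

lemma adj_comp_adj [simp]: "adj i \<circ> adj i = id"
  by (auto simp: fun_eq_iff)

lemma adj_comp_adj_comp [simp]: "adj i \<circ> (adj i \<circ> w) = w"
  by (auto simp: fun_eq_iff)

lemma adj_zero: "1 \<le> i \<Longrightarrow> adj i 0 = 0"
  by (simp add: adj_simps)

lemma adj_less_iff:
  assumes "\<not> (x = i \<and> y = Suc i)" "\<not> (x = Suc i \<and> y = i)"
  shows "adj i x < adj i y \<longleftrightarrow> x < y"
  using assms by (auto simp: adj_def transpose_def)

lemma adj_permutes: "1 \<le> i \<Longrightarrow> i < n \<Longrightarrow> adj i permutes {1..n}"
  unfolding adj_def by (rule permutes_swap_id) auto

lemma tab_act_adj_adj [simp]: "tab_act (adj i) (tab_act (adj i) T) = T"
  by (simp add: tab_act_def)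

text \<open>Unless both letters lie in \<open>E\<close>, the transposition of \<open>i\<close> and \<open>i + 1\<close> is increasing on \<open>E\<close>, since
  no integer separates the two letters.\<close>

lemma rank_adj_separated:
  assumes "\<not> (i \<in> E \<and> Suc i \<in> E)" "e \<in> E"
  shows "rank (adj i ` E) (adj i e) = rank E e"
proof (rule rank_image[OF _ assms(2)], rule strict_mono_onI)
  fix x y assume "x \<in> E" "y \<in> E" "x < y"
  moreover have "\<not> (x = i \<and> y = Suc i)" "\<not> (x = Suc i \<and> y = i)"
    using assms(1) \<open>x \<in> E\<close> \<open>y \<in> E\<close> by auto
  ultimately show "adj i x < adj i y" by (simp add: adj_less_iff)
qed

lemma rank_Suc:
  assumes "finite E" "i \<in> E" "Suc i \<in> E"
  shows "rank E (Suc i) = Suc (rank E i)"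
proof -
  have "{e' \<in> E. e' \<le> Suc i} = insert (Suc i) {e' \<in> E. e' \<le> i}"
    using assms by (auto simp: le_Suc_eq)
  then show ?thesis unfolding rank_def using assms(1) by simp
qed

lemma adj_image_joined:
  assumes "i \<in> E" "Suc i \<in> E"
  shows "adj i ` E = E"
proof -
  have *: "adj i ` E \<subseteq> E" using assms by (auto simp: adj_def transpose_def)
  then have "adj i ` (adj i ` E) \<subseteq> adj i ` E" by blast
  then show ?thesis using * by (simp add: image_image)
qed

text \<open>Consecutive letters of \<open>E\<close> get consecutive ranks, so relabelling turns an adjacent transposition
  into an adjacent transposition.\<close>

lemma rank_adj_joined:
  assumes "finite E" "i \<in> E" "Suc i \<in> E" "e \<in> E"
  shows "rank E (adj i e) = adj (rank E i) (rank E e)"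
proof -
  consider "e = i" | "e = Suc i" | "e \<noteq> i" "e \<noteq> Suc i" by blast
  then show ?thesis
  proof cases
    case 3
    then have "rank E e \<noteq> rank E i" "rank E e \<noteq> Suc (rank E i)"
      using assms rank_eq_iff[of E e i] rank_eq_iff[of E e "Suc i"] rank_Suc[of E i] by simp_all
    with 3 show ?thesis by (simp add: adj_simps)
  qed (use assms in \<open>simp_all add: adj_simps rank_Suc\<close>)
qed

section \<open>Bruhat order\<close>

text \<open>Apply the transposition \<open>t\<close> of \<open>a\<close> and \<open>b\<close> to both positions of an inversion of \<open>u\<close> if this keeps
  them in order, and leave the inversion alone otherwise.  This is an involution on ordered pairs of
  positions, and it sends inversions of \<open>u\<close> to inversions of \<open>u \<circ> t\<close>; the new inversion \<open>(a, b)\<close> is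
  missed.\<close>

lemma perm_length_transpose_less:
  assumes "a \<in> {1..n}" "b \<in> {1..n}" "a < b" "u a < u b"
  shows "perm_length n u < perm_length n (u \<circ> Transposition.transpose a b)"
proof -
  define t where "t = Transposition.transpose a b"
  define invs where "invs w = {(i, j). 1 \<le> i \<and> i < j \<and> j \<le> n \<and> w j < w i}" for w :: "nat \<Rightarrow> nat"
  define \<phi> where "\<phi> = (\<lambda>(i, j). if t i < t j then (t i, t j) else (i, j))"
  have fin: "finite (invs w)" for w
    by (rule finite_subset[of _ "{1..n} \<times> {1..n}"]) (auto simp: invs_def)
  have tt: "t (t x) = x" for x by (simp add: t_def)
  have invol: "\<phi> (\<phi> (i, j)) = (i, j)" if "i < j" for i j
    using that by (simp add: \<phi>_def tt)
  have inj: "inj_on \<phi> (invs u)"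
  proof (rule inj_on_inverseI[where g = \<phi>])
    fix p assume "p \<in> invs u"
    then show "\<phi> (\<phi> p) = p" using invol by (auto simp: invs_def)
  qed
  have ab: "\<phi> (a, b) = (a, b)" using assms by (simp add: \<phi>_def t_def)
  have "\<phi> p \<in> invs (u \<circ> t) - {(a, b)}" if "p \<in> invs u" for p
  proof -
    obtain i j where p: "p = (i, j)" by force
    have ij: "1 \<le> i" "i < j" "j \<le> n" "u j < u i" using that by (auto simp: invs_def p)
    have tr: "1 \<le> t x \<and> t x \<le> n" if "1 \<le> x" "x \<le> n" for x
      using that assms by (auto simp: t_def transpose_def)
    have "\<phi> p \<in> invs (u \<circ> t)"
    proof (cases "t i < t j")
      case True
      then show ?thesis using ij tr[of i] tr[of j] by (simp add: invs_def \<phi>_def p tt)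
    next
      case False
      \<comment> \<open>One of the positions is \<open>a\<close> or \<open>b\<close> and the other lies between them, so \<open>t\<close> raises \<open>u i\<close> or
        lowers \<open>u j\<close>.\<close>
      then have "u (t j) < u (t i)"
        using ij assms by (auto simp: t_def transpose_def split: if_splits)
      with False show ?thesis using ij by (simp add: invs_def \<phi>_def p)
    qed
    moreover have "\<phi> p \<noteq> (a, b)"
    proof
      assume "\<phi> p = (a, b)"
      then have "p = (a, b)" using invol[OF ij(2)] ab by (simp add: p)
      with ij assms show False by (simp add: p)
    qed
    ultimately show ?thesis by simp
  qed
  then have sub: "\<phi> ` invs u \<subseteq> invs (u \<circ> t) - {(a, b)}" by (rule image_subsetI)
  have "(a, b) \<in> invs (u \<circ> t)" using assms by (simp add: invs_def t_def)
  then have "\<phi> ` invs u \<subset> invs (u \<circ> t)" using sub by blast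
  then have "card (\<phi> ` invs u) < card (invs (u \<circ> t))" by (rule psubset_card_mono[OF fin])
  then show ?thesis using inj by (simp add: card_image perm_length_def invs_def t_def)
qed

lemma perm_length_transpose_less_iff:
  assumes "u permutes {1..n}" "a \<in> {1..n}" "b \<in> {1..n}" "a < b"
  shows "perm_length n u < perm_length n (u \<circ> Transposition.transpose a b) \<longleftrightarrow> u a < u b"
proof
  assume *: "perm_length n u < perm_length n (u \<circ> Transposition.transpose a b)"
  show "u a < u b"
  proof (rule ccontr)
    assume "\<not> u a < u b"
    moreover have "u a \<noteq> u b" using assms permutes_inj[OF assms(1)] by (auto simp: inj_def)
    ultimately have "(u \<circ> Transposition.transpose a b) a < (u \<circ> Transposition.transpose a b) b" by simp
    from perm_length_transpose_less[of a n b "u \<circ> Transposition.transpose a b", OF assms(2-4) this] *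
    show False
      by (simp add: comp_assoc)
  qed
qed (rule perm_length_transpose_less[OF assms(2-4)])

lemma adj_comp_eq_transpose:
  assumes "u permutes S" "u a = i" "u b = Suc i"
  shows "adj i \<circ> u = u \<circ> Transposition.transpose a b"
proof
  fix x
  have "u x = i \<longleftrightarrow> x = a" "u x = Suc i \<longleftrightarrow> x = b"
    using inj_eq[OF permutes_inj[OF assms(1)], of x a] inj_eq[OF permutes_inj[OF assms(1)], of x b]
    by (simp_all add: assms(2,3))
  then show "(adj i \<circ> u) x = (u \<circ> Transposition.transpose a b) x"
    using assms by (auto simp: adj_def transpose_def)
qed

lemma bruhat_stepI:
  assumes "a \<in> {1..n}" "b \<in> {1..n}" "a < b" "u a < u b"
    and "w = u \<circ> Transposition.transpose a b"
  shows "bruhat_step n u w"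
proof -
  have "perm_length n u < perm_length n w"
    unfolding assms(5) by (rule perm_length_transpose_less[OF assms(1-4)])
  then show ?thesis unfolding bruhat_step_def using assms by (metis less_irrefl)
qed

lemma bruhat_step_permutes:
  assumes "bruhat_step n u w" "u permutes {1..n}"
  shows "w permutes {1..n}"
proof -
  obtain a b where "a \<in> {1..n}" "b \<in> {1..n}" "w = u \<circ> Transposition.transpose a b"
    using assms(1) by (auto simp: bruhat_step_def)
  then show ?thesis using assms(2) by (simp add: permutes_compose permutes_swap_id)
qed

text \<open>Left multiplication by \<open>s\<^sub>i\<close> preserves the order of the values \<open>u a < u b\<close> exchanged by a Bruhat step,
  unless they are \<open>i\<close> and \<open>i + 1\<close>; in that case the step itself is left multiplication by \<open>s\<^sub>i\<close>.\<close>

lemma bruhat_step_adj: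
  assumes step: "bruhat_step n u w" and u: "u permutes {1..n}" and i: "1 \<le> i" "i < n"
  shows "adj i \<circ> u = w \<or> bruhat_step n (adj i \<circ> u) (adj i \<circ> w)"
proof -
  obtain a b where ab: "a \<in> {1..n}" "b \<in> {1..n}" "a < b" "w = u \<circ> Transposition.transpose a b"
    and len: "perm_length n u < perm_length n w"
  proof -
    obtain a b where *: "a \<in> {1..n}" "b \<in> {1..n}" "a \<noteq> b" "w = u \<circ> Transposition.transpose a b"
      "perm_length n u < perm_length n w"
      using step by (auto simp: bruhat_step_def)
    show ?thesis
    proof (cases "a < b")
      case True
      then show ?thesis using * that by blast
    next
      case False
      then have "b < a" using *(3) by simp
      then show ?thesis using * that[of b a] by (simp add: transpose_commute)
    qed
  qed
  have lt: "u a < u b" using perm_length_transpose_less_iff[OF u ab(1-3)] len ab(4) by simp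
  show ?thesis
  proof (cases "u a = i \<and> u b = Suc i")
    case True
    then show ?thesis using adj_comp_eq_transpose[OF u] ab(4) by blast
  next
    case False
    then have "(adj i \<circ> u) a < (adj i \<circ> u) b" using lt adj_less_iff[of "u a" i "u b"] by auto
    moreover have "adj i \<circ> w = (adj i \<circ> u) \<circ> Transposition.transpose a b"
      by (simp add: ab(4) comp_assoc)
    ultimately show ?thesis using bruhat_stepI[OF ab(1-3)] by blast
  qed
qed

lemma bruhat_le_refl: "bruhat_le n w w"
  by (simp add: bruhat_le_def)

lemma bruhat_le_step: "bruhat_le n u v \<Longrightarrow> bruhat_step n v w \<Longrightarrow> bruhat_le n u w"
  unfolding bruhat_le_def by (erule rtranclp.rtrancl_into_rtrancl)

text \<open>The lifting property of the Bruhat order: a chain of steps from \<open>u\<close> to \<open>w\<close> becomes a chain from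
  \<open>s\<^sub>i u\<close> to \<open>s\<^sub>i w\<close> under left multiplication, except that it may meet a step that is itself left
  multiplication by \<open>s\<^sub>i\<close>; there it joins the original chain.\<close>

lemma bruhat_le_adj_lift:
  assumes "bruhat_le n u w" "u permutes {1..n}" "1 \<le> i" "i < n"
  shows "bruhat_le n (adj i \<circ> u) w \<or> bruhat_le n (adj i \<circ> u) (adj i \<circ> w)"
proof -
  have "w permutes {1..n} \<and> (bruhat_le n (adj i \<circ> u) w \<or> bruhat_le n (adj i \<circ> u) (adj i \<circ> w))"
    using assms(1)[unfolded bruhat_le_def]
  proof (induction rule: rtranclp_induct)
    case base
    then show ?case using assms(2) by (simp add: bruhat_le_refl)
  next
    case (step v v')
    from step(3) have v: "v permutes {1..n}" by blast
    have "bruhat_le n (adj i \<circ> u) v' \<or> bruhat_le n (adj i \<circ> u) (adj i \<circ> v')"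
      using step(3) bruhat_step_adj[OF step(2) v assms(3,4)] bruhat_le_step[OF _ step(2)]
        bruhat_le_step[of n "adj i \<circ> u" "adj i \<circ> v" "adj i \<circ> v'"]
      by (auto simp del: o_apply simp: bruhat_le_refl)
    with bruhat_step_permutes[OF step(2) v] show ?case by blast
  qed
  then show ?thesis by blast
qed

text \<open>An ascending permutation satisfies \<open>i \<le> w i\<close>, and then fixes \<open>n\<close>, \<open>n - 1\<close>, and so on downwards by
  injectivity.\<close>

lemma permutation_without_descent:
  assumes w: "w permutes {1..n}"
    and asc: "\<And>i. 1 \<le> i \<Longrightarrow> i < n \<Longrightarrow> w i < w (Suc i)"
  shows "w = id"
proof -
  have ge: "i \<le> w i" if "i \<le> n" for i
    using that
  proof (induction i)
    case (Suc i)
    show ?case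
    proof (cases "i = 0")
      case True
      have "w (Suc i) \<in> {1..n}" using permutes_in_image[OF w, of "Suc i"] Suc by simp
      then show ?thesis using True by simp
    next
      case False
      then show ?thesis using asc[of i] Suc by simp
    qed
  qed simp
  have "i \<in> {1..n} \<Longrightarrow> w i = i" for i
  proof (induction "n - i" arbitrary: i rule: less_induct)
    case less
    show ?case
    proof (rule ccontr)
      assume "w i \<noteq> i"
      then have gt: "i < w i" using ge[of i] less(2) by simp
      have "w i \<in> {1..n}" using permutes_in_image[OF w, of i] less(2) by simp
      with gt have "w (w i) = w i" using less(1)[of "w i"] by (simp add: diff_less_mono2)
      then have "w i = i" using inj_eq[OF permutes_inj[OF w]] by blast
      with gt show False by simp
    qed
  qed
  then show ?thesis using permutes_not_in[OF w] by (auto simp: fun_eq_iff)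
qed

section \<open>Tableaux and their permutations\<close>

text \<open>The total order of the boxes by component, then column, then row, in the form used by the
  definition of the column reading tableau.\<close>

definition reads_upto :: "box \<Rightarrow> box \<Rightarrow> bool" where
  "reads_upto = (\<lambda>(k', x', y') (k, x, y). k' < k \<or> (k' = k \<and> (y' < y \<or> (y' = y \<and> x' \<le> x))))"

definition in_line_before :: "box \<Rightarrow> box \<Rightarrow> bool" where
  "in_line_before = (\<lambda>(k, x, y) (k', x', y'). k = k' \<and> (x = x' \<and> y < y' \<or> y = y' \<and> x < x'))"

lemma standard_iff:
  "standard lam T \<longleftrightarrow> (\<forall>b \<in> boxes lam. \<forall>c \<in> boxes lam. in_line_before b c \<longrightarrow> T b < T c)"
  unfolding standard_def in_line_before_def by fast

lemma boxes_Sigma: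
  "boxes lam = (SIGMA k:{..<length lam}. SIGMA x:{..<length (lam ! k)}. {..<lam ! k ! x})"
  by (auto simp: boxes_def)

lemma finite_boxes [simp]: "finite (boxes lam)"
  unfolding boxes_Sigma by blast

lemma card_boxes: "card (boxes lam) = rsize lam"
  unfolding boxes_Sigma rsize_def by (simp add: sum_list_sum_nth atLeast0LessThan)

lemma column_reading_box:
  "b \<in> boxes lam \<Longrightarrow> column_reading lam b = card {c \<in> boxes lam. reads_upto c b}"
  unfolding column_reading_def reads_upto_def
  by (cases b) (auto intro!: arg_cong[where f = card])

lemma column_reading_le_iff:
  "b \<in> boxes lam \<Longrightarrow> c \<in> boxes lam \<Longrightarrow>
    column_reading lam b \<le> column_reading lam c \<longleftrightarrow> reads_upto b c"
  unfolding column_reading_box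
  by (rule position_le_iff) (auto simp: reads_upto_def)

lemma column_reading_is_tableau: "is_tableau lam (column_reading lam)"
proof -
  have "bij_betw (\<lambda>b. card {c \<in> boxes lam. reads_upto c b}) (boxes lam) {1..card (boxes lam)}"
    by (rule position_bij) (auto simp: reads_upto_def)
  then have "bij_betw (column_reading lam) (boxes lam) {1..rsize lam}"
    by (subst bij_betw_cong[OF column_reading_box]) (simp_all add: card_boxes)
  then show ?thesis by (auto simp: is_tableau_def column_reading_def)
qed

lemma column_reading_standard: "standard lam (column_reading lam)"
  unfolding standard_iff
proof (intro ballI impI)
  fix b c assume *: "b \<in> boxes lam" "c \<in> boxes lam" "in_line_before b c"
  then have "\<not> reads_upto c b" by (auto simp: in_line_before_def reads_upto_def)
  then show "column_reading lam b < column_reading lam c"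
    using column_reading_le_iff[OF *(2,1)] by simp
qed

lemma column_reading_SYT: "column_reading lam \<in> SYT lam"
  by (simp add: SYT_def column_reading_is_tableau column_reading_standard)

lemma is_tableau_bij: "is_tableau lam T \<Longrightarrow> bij_betw T (boxes lam) {1..rsize lam}"
  by (simp add: is_tableau_def)

lemma is_tableau_outside: "is_tableau lam T \<Longrightarrow> b \<notin> boxes lam \<Longrightarrow> T b = 0"
  unfolding is_tableau_def by blast

lemma is_tableau_range: "is_tableau lam T \<Longrightarrow> b \<in> boxes lam \<Longrightarrow> T b \<in> {1..rsize lam}"
  using bij_betwE[OF is_tableau_bij] by blast

lemma is_tableau_eq_iff:
  "is_tableau lam T \<Longrightarrow> b \<in> boxes lam \<Longrightarrow> c \<in> boxes lam \<Longrightarrow> T b = T c \<longleftrightarrow> b = c"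
  using is_tableau_bij[of lam T] by (auto simp: bij_betw_def inj_on_def)

lemma tab_act_tableau:
  assumes "w permutes {1..rsize lam}" "is_tableau lam T"
  shows "is_tableau lam (tab_act w T)"
  using bij_betw_trans[OF is_tableau_bij[OF assms(2)] permutes_imp_bij[OF assms(1)]]
    permutes_not_in[OF assms(1), of 0] assms(2)
  by (simp add: is_tableau_def tab_act_def)

lemma SYT_tableau: "T \<in> SYT lam \<Longrightarrow> is_tableau lam T"
  by (simp add: SYT_def)

lemma finite_SYT [simp]: "finite (SYT lam)"
proof (rule finite_subset)
  show "SYT lam \<subseteq> {f. \<forall>b. (b \<in> boxes lam \<longrightarrow> f b \<in> {1..rsize lam}) \<and> (b \<notin> boxes lam \<longrightarrow> f b = 0)}"
    using is_tableau_range is_tableau_outside by (auto dest!: SYT_tableau)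
  show "finite \<dots>" by (rule finite_set_of_finite_funs) auto
qed

lemma tab_perm_eqI:
  assumes w: "w permutes {1..rsize lam}" "tab_act w (column_reading lam) = T"
  shows "tab_perm lam T = w"
  unfolding tab_perm_def
proof (rule the_equality)
  fix u assume u: "u permutes {1..rsize lam} \<and> tab_act u (column_reading lam) = T"
  show "u = w"
  proof
    fix m
    show "u m = w m"
    proof (cases "m \<in> {1..rsize lam}")
      case True
      then obtain b where "m = column_reading lam b"
        using bij_betw_imp_surj_on[OF is_tableau_bij[OF column_reading_is_tableau]] by blast
      moreover have "(u \<circ> column_reading lam) b = (w \<circ> column_reading lam) b"
        using u w(2) by (simp add: tab_act_def)
      ultimately show ?thesis by simp
    next
      case False
      then show ?thesis using u w(1) by (metis permutes_not_in)
    qed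
  qed
qed (use w in simp)

lemma tab_perm:
  assumes "is_tableau lam T"
  shows "tab_perm lam T permutes {1..rsize lam}" (is ?perm)
    and "tab_act (tab_perm lam T) (column_reading lam) = T" (is ?act)
proof -
  let ?C = "column_reading lam" and ?B = "boxes lam" and ?N = "{1..rsize lam}"
  define w where "w m = (if m \<in> ?N then T (inv_into ?B ?C m) else m)" for m
  note C = is_tableau_bij[OF column_reading_is_tableau, of lam]
  have "bij_betw (T \<circ> inv_into ?B ?C) ?N ?N"
    using bij_betw_inv_into[OF C] is_tableau_bij[OF assms] by (rule bij_betw_trans)
  then have "bij_betw w ?N ?N" by (subst bij_betw_cong[where g = "T \<circ> inv_into ?B ?C"]) (simp_all add: w_def)
  then have w: "w permutes ?N" by (rule bij_imp_permutes) (simp only: w_def if_False)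
  have "w (?C b) = T b" for b
  proof (cases "b \<in> ?B")
    case True
    then show ?thesis using bij_betwE[OF C] bij_betw_inv_into_left[OF C] by (simp add: w_def)
  next
    case False
    then show ?thesis
      using is_tableau_outside[OF assms] is_tableau_outside[OF column_reading_is_tableau]
      by (simp add: w_def)
  qed
  then have "tab_act w ?C = T" by (simp add: tab_act_def fun_eq_iff)
  with w tab_perm_eqI[OF w this] show ?perm ?act by simp_all
qed

lemma tab_perm_column_reading: "tab_perm lam (column_reading lam) = id"
  by (rule tab_perm_eqI) (simp_all add: permutes_id tab_act_def)

lemma tab_perm_act:
  assumes "w permutes {1..rsize lam}" "is_tableau lam T"
  shows "tab_perm lam (tab_act w T) = w \<circ> tab_perm lam T"
proof (rule tab_perm_eqI)
  show "w \<circ> tab_perm lam T permutes {1..rsize lam}"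
    using permutes_compose[OF tab_perm(1)[OF assms(2)] assms(1)] .
  show "tab_act (w \<circ> tab_perm lam T) (column_reading lam) = tab_act w T"
    using tab_perm(2)[OF assms(2)] by (simp add: tab_act_def comp_assoc)
qed

text \<open>With \<open>v\<close> the inverse of the permutation \<open>w\<close> of \<open>T\<close>, the number \<open>v m\<close> is the reading position of the
  entry \<open>m\<close>.  A descent \<open>v (i + 1) < v i\<close> exists because \<open>w\<close> is not the identity.  Exchanging \<open>i\<close> and
  \<open>i + 1\<close> could only spoil standardness if the box of \<open>i\<close> preceded the box of \<open>i + 1\<close> in a row or
  column, but then it would also be read first.\<close>

lemma SYT_descent:
  assumes T: "T \<in> SYT lam" "T \<noteq> column_reading lam"
  obtains i where "1 \<le> i" "i < rsize lam" "tab_act (adj i) T \<in> SYT lam"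
    "bruhat_step (rsize lam) (tab_perm lam (tab_act (adj i) T)) (tab_perm lam T)"
proof -
  let ?n = "rsize lam" and ?C = "column_reading lam"
  define w where "w = tab_perm lam T"
  define v where "v = Hilbert_Choice.inv w"
  note tab = SYT_tableau[OF T(1)]
  have w: "w permutes {1..?n}" and wC: "tab_act w ?C = T"
    using tab_perm[OF tab] by (simp_all add: w_def)
  have v: "v permutes {1..?n}" unfolding v_def using w by (rule permutes_inv)
  have wv: "w (v m) = m" and vw: "v (w m) = m" for m
    unfolding v_def using permutes_inverses[OF w] by simp_all
  have "v \<noteq> id"
  proof
    assume "v = id"
    then have "w = id" using wv by (simp add: fun_eq_iff)
    then show False using wC T(2) by (simp add: tab_act_def)
  qed
  then obtain i where i: "1 \<le> i" "i < ?n" "\<not> v i < v (Suc i)"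
    using permutation_without_descent[OF v] by blast
  define a b where "a = v (Suc i)" and "b = v i"
  have wab: "w a = Suc i" "w b = i" by (simp_all add: a_def b_def wv)
  then have "a < b" using i(3) by (cases "a = b") (auto simp: a_def b_def)
  have mem: "a \<in> {1..?n}" "b \<in> {1..?n}"
    using i permutes_in_image[OF v] by (simp_all add: a_def b_def)
  have ai: "adj i permutes {1..?n}" using i(1,2) by (rule adj_permutes)
  let ?u = "adj i \<circ> w"
  have uw: "w = ?u \<circ> Transposition.transpose a b"
    using adj_comp_eq_transpose[OF w wab(2,1)] by (simp add: transpose_commute comp_assoc)
  have "?u a < ?u b" using wab by (simp add: adj_simps)
  then have "bruhat_step ?n ?u w" by (rule bruhat_stepI[OF mem \<open>a < b\<close> _ uw])
  moreover have "tab_perm lam (tab_act (adj i) T) = ?u"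
    unfolding w_def by (rule tab_perm_act[OF ai tab])
  moreover have "standard lam (tab_act (adj i) T)"
    unfolding standard_iff
  proof (intro ballI impI)
    fix c d assume cd: "c \<in> boxes lam" "d \<in> boxes lam" "in_line_before c d"
    have TC: "v (T e) = ?C e" for e using vw[of "?C e"] wC by (auto simp: tab_act_def)
    have "?C c < ?C d" using column_reading_standard cd by (simp add: standard_iff)
    then have "\<not> (T c = i \<and> T d = Suc i)" using TC[of c] TC[of d] i(3) by auto
    moreover have "T c < T d" using T(1) cd by (simp add: SYT_def standard_iff)
    ultimately show "tab_act (adj i) T c < tab_act (adj i) T d"
      using adj_less_iff[of "T c" i "T d"] by (auto simp: tab_act_def)
  qed
  ultimately show ?thesis
    using that[OF i(1,2)] tab_act_tableau[OF ai tab] by (simp add: SYT_def w_def)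
qed

text \<open>Induction along ascending chains of the weak order that start at the column reading tableau and stay
  inside the standard tableaux.\<close>

lemma SYT_induct [consumes 1, case_names column_reading ascent]:
  assumes "T \<in> SYT lam"
    and base: "P (column_reading lam)"
    and step: "\<And>S i. S \<in> SYT lam \<Longrightarrow> 1 \<le> i \<Longrightarrow> i < rsize lam \<Longrightarrow>
      bruhat_step (rsize lam) (tab_perm lam S) (tab_perm lam (tab_act (adj i) S)) \<Longrightarrow>
      P S \<Longrightarrow> P (tab_act (adj i) S)"
  shows "P T"
  using assms(1)
proof (induction "perm_length (rsize lam) (tab_perm lam T)" arbitrary: T rule: less_induct)
  case less
  show ?case
  proof (cases "T = column_reading lam")
    case False
    then obtain i where i: "1 \<le> i" "i < rsize lam" "tab_act (adj i) T \<in> SYT lam"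
      "bruhat_step (rsize lam) (tab_perm lam (tab_act (adj i) T)) (tab_perm lam T)"
      using SYT_descent less(2) by metis
    from i(4) have "perm_length (rsize lam) (tab_perm lam (tab_act (adj i) T))
      < perm_length (rsize lam) (tab_perm lam T)" by (simp add: bruhat_step_def)
    then have "P (tab_act (adj i) T)" using less(1) i(3) by blast
    then show ?thesis using step[OF i(3,1,2)] i(4) by simp
  qed (simp add: base)
qed

lemma box_of_entry: "is_tableau lam T \<Longrightarrow> b \<in> boxes lam \<Longrightarrow> box_of T (T b) = b"
  unfolding box_of_def
proof (rule the_equality)
  fix c assume *: "is_tableau lam T" "b \<in> boxes lam" "T c = T b"
  then have "c \<in> boxes lam"
    using is_tableau_outside[of lam T c] is_tableau_range[of lam T b] by fastforce
  with * show "c = b" using is_tableau_eq_iff by blast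
qed simp

lemma box_of:
  assumes "is_tableau lam T" "i \<in> {1..rsize lam}"
  shows "box_of T i \<in> boxes lam" "T (box_of T i) = i"
proof -
  obtain b where "b \<in> boxes lam" "i = T b"
    using bij_betw_imp_surj_on[OF is_tableau_bij[OF assms(1)]] assms(2) by blast
  then show "box_of T i \<in> boxes lam" "T (box_of T i) = i"
    using box_of_entry[OF assms(1)] by simp_all
qed

lemma mem_entries_iff:
  assumes "is_tableau lam T"
  shows "e \<in> entries lam T k \<longleftrightarrow> e \<in> {1..rsize lam} \<and> comp_of T e = k"
proof
  assume "e \<in> entries lam T k"
  then obtain b where "b \<in> boxes lam" "fst b = k" "e = T b" by (auto simp: entries_def)
  then show "e \<in> {1..rsize lam} \<and> comp_of T e = k"
    using box_of_entry[OF assms] is_tableau_range[OF assms] by (simp add: comp_of_def)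
next
  assume *: "e \<in> {1..rsize lam} \<and> comp_of T e = k"
  then show "e \<in> entries lam T k"
    using box_of[OF assms, of e] by (auto simp: entries_def comp_of_def intro!: rev_image_eqI)
qed

lemma entry_mem_entries: "(k, x, y) \<in> boxes lam \<Longrightarrow> T (k, x, y) \<in> entries lam T k"
  by (auto simp: entries_def)

lemma finite_entries [simp]: "finite (entries lam T k)"
  by (simp add: entries_def)

lemma zero_notin_entries: "is_tableau lam T \<Longrightarrow> 0 \<notin> entries lam T k"
  by (simp add: mem_entries_iff)

lemma comp_of_less: "is_tableau lam T \<Longrightarrow> i \<in> {1..rsize lam} \<Longrightarrow> comp_of T i < length lam"
  using box_of(1)[of lam T i] by (auto simp: comp_of_def boxes_def)

lemma entries_act: "entries lam (tab_act w T) k = w ` entries lam T k"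
  by (simp add: entries_def tab_act_def image_image)

lemma alphabet_eq_iff:
  "alphabet lam S = alphabet lam T \<longleftrightarrow> (\<forall>k<length lam. entries lam S k = entries lam T k)"
  by (auto simp: alphabet_def)

lemma alphabet_act: "alphabet lam (tab_act w T) = map ((`) w) (alphabet lam T)"
  by (simp add: alphabet_def entries_act)

lemma alphabet_act_cong:
  "alphabet lam S = alphabet lam T \<Longrightarrow> alphabet lam (tab_act w S) = alphabet lam (tab_act w T)"
  by (simp add: alphabet_act)

lemma alphabet_adj_iff:
  "alphabet lam (tab_act (adj i) R) = alphabet lam S \<longleftrightarrow>
    alphabet lam R = alphabet lam (tab_act (adj i) S)"
  using alphabet_act_cong[of lam "tab_act (adj i) R" S "adj i"]
    alphabet_act_cong[of lam R "tab_act (adj i) S" "adj i"] by auto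

text \<open>Exchanging two entries within one component does not change the set of its entries.\<close>

lemma alphabet_adj_joined:
  assumes R: "is_tableau lam R" and i: "1 \<le> i" "i < rsize lam" "comp_of R i = comp_of R (Suc i)"
  shows "alphabet lam (tab_act (adj i) R) = alphabet lam R"
  unfolding alphabet_eq_iff
proof (intro allI impI)
  fix k
  show "entries lam (tab_act (adj i) R) k = entries lam R k"
  proof (cases "comp_of R i = k")
    case True
    then have "i \<in> entries lam R k" "Suc i \<in> entries lam R k"
      using i by (simp_all add: mem_entries_iff[OF R])
    then show ?thesis by (simp add: entries_act adj_image_joined)
  next
    case False
    then have "adj i e = e" if "e \<in> entries lam R k" for e
      using that i(3) by (metis adj_simps(3) mem_entries_iff[OF R])
    then show ?thesis by (simp add: entries_act)
  qed
qed

lemma comp_of_cong: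
  assumes "is_tableau lam S" "is_tableau lam T" "alphabet lam S = alphabet lam T"
    "e \<in> {1..rsize lam}"
  shows "comp_of S e = comp_of T e"
proof -
  have "e \<in> entries lam S (comp_of S e)" using assms by (simp add: mem_entries_iff)
  then have "e \<in> entries lam T (comp_of S e)"
    using assms comp_of_less[of lam S e] by (simp add: alphabet_eq_iff)
  then show ?thesis using assms by (simp add: mem_entries_iff)
qed

section \<open>Components of a tableau\<close>

lemma component_apply: "component lam T k (0, x, y) = rank (entries lam T k) (T (k, x, y))"
  by (simp add: component_def)

lemma component_apply_nonzero: "m \<noteq> 0 \<Longrightarrow> component lam T k (m, x, y) = 0"
  by (simp add: component_def)

lemma boxes_single_iff:
  "k < length lam \<Longrightarrow> (m, x, y) \<in> boxes [lam ! k] \<longleftrightarrow> m = 0 \<and> (k, x, y) \<in> boxes lam"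
  by (auto simp: boxes_def)

lemma boxes_single_bij:
  assumes "k < length lam"
  shows "bij_betw (\<lambda>(m, x, y). (k, x, y)) (boxes [lam ! k]) {b \<in> boxes lam. fst b = k}"
  by (rule bij_betwI[where g = "\<lambda>(m, x, y). (0, x, y)"]) (auto simp: boxes_single_iff assms)

lemma entries_bij:
  "is_tableau lam T \<Longrightarrow> bij_betw T {b \<in> boxes lam. fst b = k} (entries lam T k)"
  unfolding entries_def using is_tableau_bij[of lam T]
  by (auto simp: bij_betw_def intro: inj_on_subset)

lemma card_entries:
  assumes T: "is_tableau lam T" and k: "k < length lam"
  shows "card (entries lam T k) = rsize [lam ! k]"
  using bij_betw_same_card[OF boxes_single_bij[OF k]] bij_betw_same_card[OF entries_bij[OF T, of k]]
  by (simp add: card_boxes)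

lemma component_is_tableau:
  assumes T: "is_tableau lam T" and k: "k < length lam"
  shows "is_tableau [lam ! k] (component lam T k)"
proof -
  let ?E = "entries lam T k" and ?B = "{b \<in> boxes lam. fst b = k}"
  have "card ?E = rsize [lam ! k]" by (rule card_entries[OF T k])
  then have "bij_betw (rank ?E \<circ> (T \<circ> (\<lambda>(m, x, y). (k, x, y)))) (boxes [lam ! k]) {1..rsize [lam ! k]}"
    using bij_betw_trans[OF bij_betw_trans[OF boxes_single_bij[OF k] entries_bij[OF T]] rank_bij[of ?E]]
    by simp
  then have "bij_betw (component lam T k) (boxes [lam ! k]) {1..rsize [lam ! k]}"
    by (rule bij_betw_cong[THEN iffD1, rotated]) (auto simp: boxes_single_iff k component_apply)
  moreover have "component lam T k (m, x, y) = 0" if "(m, x, y) \<notin> boxes [lam ! k]" for m x y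
  proof (cases "m = 0")
    case True
    with that k have "T (k, x, y) = 0" using is_tableau_outside[OF T] by (simp add: boxes_single_iff)
    with True show ?thesis by (simp add: component_apply rank_zero zero_notin_entries[OF T])
  qed (simp add: component_apply_nonzero)
  ultimately show ?thesis by (auto simp: is_tableau_def)
qed

lemma component_less_iff:
  assumes "is_tableau lam T" "(k, x, y) \<in> boxes lam" "(k, x', y') \<in> boxes lam"
  shows "component lam T k (0, x, y) < component lam T k (0, x', y') \<longleftrightarrow> T (k, x, y) < T (k, x', y')"
  using assms by (simp add: component_apply rank_less_iff entry_mem_entries)

lemma standard_iff_components:
  assumes "is_tableau lam T"
  shows "standard lam T \<longleftrightarrow> (\<forall>k<length lam. standard [lam ! k] (component lam T k))"
proof
  assume *: "standard lam T"
  show "\<forall>k<length lam. standard [lam ! k] (component lam T k)"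
    unfolding standard_iff
  proof (intro allI impI ballI)
    fix k b c
    assume k: "k < length lam" and b: "b \<in> boxes [lam ! k]" "c \<in> boxes [lam ! k]" "in_line_before b c"
    obtain x y x' y' where bc: "b = (0, x, y)" "c = (0, x', y')"
      "(k, x, y) \<in> boxes lam" "(k, x', y') \<in> boxes lam"
      using b(1,2) boxes_single_iff[OF k] by (metis prod_cases3)
    have "in_line_before (k, x, y) (k, x', y')" using b(3) bc by (simp add: in_line_before_def)
    then show "component lam T k b < component lam T k c"
      using * bc component_less_iff[OF assms] by (simp add: standard_iff)
  qed
next
  assume *: "\<forall>k<length lam. standard [lam ! k] (component lam T k)"
  show "standard lam T"
    unfolding standard_iff
  proof (intro ballI impI)
    fix b c assume b: "b \<in> boxes lam" "c \<in> boxes lam" "in_line_before b c"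
    obtain k x y x' y' where bc: "b = (k, x, y)" "c = (k, x', y')"
      using b(3) by (auto simp: in_line_before_def)
    have k: "k < length lam" using b(1) bc by (simp add: boxes_def)
    have "(0, x, y) \<in> boxes [lam ! k]" "(0, x', y') \<in> boxes [lam ! k]"
      "in_line_before (0, x, y) (0, x', y')"
      using b bc by (simp_all add: boxes_single_iff[OF k] in_line_before_def)
    then have "component lam T k (0, x, y) < component lam T k (0, x', y')"
      using * k unfolding standard_iff by blast
    then show "T b < T c" using b bc component_less_iff[OF assms] by simp
  qed
qed

text \<open>Rows and columns never cross components, and relabelling preserves the order of the entries.  The
  direction from the components to \<open>T\<close> is needed because \<open>s\<^sub>i R\<close> may fail to be standard in the
  recursion for the coefficients; it says that the failure is visible in a component.\<close>

lemma SYT_iff_components: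
  "is_tableau lam T \<Longrightarrow> T \<in> SYT lam \<longleftrightarrow> (\<forall>k<length lam. component lam T k \<in> SYT [lam ! k])"
  using standard_iff_components component_is_tableau by (auto simp: SYT_def)

lemma component_adj_separated:
  assumes T: "is_tableau lam T" and i: "1 \<le> i" "i < rsize lam"
    and sep: "\<not> (i \<in> entries lam T k \<and> Suc i \<in> entries lam T k)"
  shows "component lam (tab_act (adj i) T) k = component lam T k"
proof -
  note aT = tab_act_tableau[OF adj_permutes[OF i] T]
  have "component lam (tab_act (adj i) T) k (m, x, y) = component lam T k (m, x, y)" for m x y
  proof (cases "m = 0 \<and> (k, x, y) \<in> boxes lam")
    case True
    then show ?thesis using rank_adj_separated[OF sep entry_mem_entries]
      by (simp add: component_apply entries_act) (simp add: tab_act_def)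
  next
    case False
    then show ?thesis
      using is_tableau_outside[OF T] is_tableau_outside[OF aT]
      by (cases "m = 0") (simp_all add: component_apply component_apply_nonzero
          rank_zero zero_notin_entries[OF T] zero_notin_entries[OF aT])
  qed
  then show ?thesis by (auto simp: fun_eq_iff)
qed

lemma component_adj_joined:
  assumes T: "is_tableau lam T" and i: "1 \<le> i" "i < rsize lam"
    and joined: "i \<in> entries lam T k" "Suc i \<in> entries lam T k"
  shows "component lam (tab_act (adj i) T) k
    = tab_act (adj (rank (entries lam T k) i)) (component lam T k)"
proof -
  let ?E = "entries lam T k"
  have pos: "1 \<le> rank ?E i"
    using bij_betwE[OF rank_bij[of ?E]] joined by auto
  note aT = tab_act_tableau[OF adj_permutes[OF i] T]
  have "component lam (tab_act (adj i) T) k (m, x, y)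
    = adj (rank ?E i) (component lam T k (m, x, y))" for m x y
  proof (cases "m = 0 \<and> (k, x, y) \<in> boxes lam")
    case True
    then show ?thesis using rank_adj_joined[OF finite_entries joined entry_mem_entries]
      by (simp add: component_apply entries_act adj_image_joined joined) (simp add: tab_act_def)
  next
    case False
    then show ?thesis
      using is_tableau_outside[OF T] is_tableau_outside[OF aT] adj_zero[OF pos]
      by (cases "m = 0") (simp_all add: component_apply component_apply_nonzero
          rank_zero zero_notin_entries[OF T] zero_notin_entries[OF aT])
  qed
  then show ?thesis by (auto simp: fun_eq_iff tab_act_def)
qed

lemma rank_joined_bounds:
  assumes T: "is_tableau lam T" and k: "k < length lam"
    and joined: "i \<in> entries lam T k" "Suc i \<in> entries lam T k"
  shows "1 \<le> rank (entries lam T k) i" "rank (entries lam T k) i < rsize [lam ! k]"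
proof -
  let ?E = "entries lam T k"
  have "card ?E = rsize [lam ! k]" by (rule card_entries[OF T k])
  moreover have "rank ?E i \<in> {1..card ?E}" "rank ?E (Suc i) \<in> {1..card ?E}"
    using bij_betwE[OF rank_bij[of ?E]] joined by auto
  ultimately show "1 \<le> rank ?E i" "rank ?E i < rsize [lam ! k]"
    using rank_Suc[of ?E i] joined by simp_all
qed

text \<open>With the value 0 for separated entries, one formula covers both cases of the action of \<open>s\<^sub>i\<close>.\<close>

definition seminormal_diag :: "tableau \<Rightarrow> nat \<Rightarrow> complex" where
  "seminormal_diag T i = (if comp_of T i = comp_of T (Suc i) then a_coeff T i else 0)"

lemma box_of_component:
  assumes T: "is_tableau lam T" and k: "k < length lam" and e: "e \<in> entries lam T k"
  shows "box_of (component lam T k) (rank (entries lam T k) e) = (0, snd (box_of T e))"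
proof -
  have e': "e \<in> {1..rsize lam}" "comp_of T e = k" using e mem_entries_iff[OF T] by auto
  obtain x y where xy: "box_of T e = (k, x, y)"
    using e'(2) by (cases "box_of T e") (auto simp: comp_of_def)
  have b: "(k, x, y) \<in> boxes lam" "T (k, x, y) = e" using box_of[OF T e'(1)] by (simp_all add: xy)
  then show ?thesis
    using box_of_entry[OF component_is_tableau[OF T k], of "(0, x, y)"]
    by (simp add: xy component_apply boxes_single_iff k)
qed

lemma content_component: "content (m, snd b) = content b"
  by (cases b) (simp add: content_def)

text \<open>Passing to a component moves no box within its component, so contents, and with them the axial
  distances, are preserved.\<close>

lemma seminormal_diag_component:
  assumes T: "is_tableau lam T" and k: "k < length lam"
    and joined: "i \<in> entries lam T k" "Suc i \<in> entries lam T k"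
  shows "seminormal_diag (component lam T k) (rank (entries lam T k) i) = seminormal_diag T i"
proof -
  have "comp_of T i = comp_of T (Suc i)" using joined by (simp add: mem_entries_iff[OF T])
  then show ?thesis
    using box_of_component[OF T k joined(1)] box_of_component[OF T k joined(2)]
    by (simp add: seminormal_diag_def a_coeff_def comp_of_def rank_Suc joined content_component)
qed

text \<open>Within one component, the order in which the boxes of \<open>lam\<close> are read is the order in which the boxes
  of the single partition are read.\<close>

lemma component_column_reading:
  assumes k: "k < length lam"
  shows "component lam (column_reading lam) k = column_reading [lam ! k]"
proof -
  let ?C = "column_reading lam" and ?p = "lam ! k"
  define \<phi> where "\<phi> = (\<lambda>(m :: nat, x :: nat, y :: nat). (k, x, y))"
  note tab = column_reading_is_tableau
  have "component lam ?C k b = column_reading [?p] b" if b: "b \<in> boxes [?p]" for b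
  proof -
    obtain x y where b': "b = (0, x, y)" "(k, x, y) \<in> boxes lam"
      using b boxes_single_iff[OF k] by (metis prod_cases3)
    have inj: "inj_on (?C \<circ> \<phi>) (boxes [?p])"
      using bij_betw_trans[OF boxes_single_bij[OF k] entries_bij[OF tab]]
      by (simp add: bij_betw_def \<phi>_def)
    have im: "entries lam ?C k = (?C \<circ> \<phi>) ` boxes [?p]"
      using bij_betw_trans[OF boxes_single_bij[OF k] entries_bij[OF tab]]
      by (simp add: bij_betw_def \<phi>_def)
    have le: "?C (\<phi> c) \<le> ?C (k, x, y) \<longleftrightarrow> reads_upto c b" if "c \<in> boxes [?p]" for c
    proof -
      obtain x' y' where c: "c = (0, x', y')" "(k, x', y') \<in> boxes lam"
        using \<open>c \<in> boxes [?p]\<close> boxes_single_iff[OF k] by (metis prod_cases3)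
      then show ?thesis
        using column_reading_le_iff[OF c(2) b'(2)] b'(1) by (simp add: \<phi>_def reads_upto_def)
    qed
    have "{e \<in> entries lam ?C k. e \<le> ?C (k, x, y)} = (?C \<circ> \<phi>) ` {c \<in> boxes [?p]. reads_upto c b}"
      unfolding im using le by auto
    then have "card {e \<in> entries lam ?C k. e \<le> ?C (k, x, y)} = card {c \<in> boxes [?p]. reads_upto c b}"
      using card_image[OF inj_on_subset[OF inj, of "{c \<in> boxes [?p]. reads_upto c b}"]] by simp
    then show ?thesis
      using column_reading_box[OF b] by (simp add: b' component_apply rank_def)
  qed
  moreover have "component lam ?C k b = column_reading [?p] b" if "b \<notin> boxes [?p]" for b
    using that is_tableau_outside[OF component_is_tableau[OF tab k]] is_tableau_outside[OF tab]
    by simp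
  ultimately show ?thesis by blast
qed

lemma tableau_eqI:
  assumes S: "is_tableau lam S" and T: "is_tableau lam T"
    and alph: "alphabet lam S = alphabet lam T"
    and comp: "\<And>k. k < length lam \<Longrightarrow> component lam S k = component lam T k"
  shows "S = T"
proof
  fix b
  show "S b = T b"
  proof (cases "b \<in> boxes lam")
    case True
    obtain k x y where b: "b = (k, x, y)" by (cases b)
    have k: "k < length lam" using True by (simp add: b boxes_def)
    have E: "entries lam S k = entries lam T k" using alph k by (simp add: alphabet_eq_iff)
    have "component lam S k (0, x, y) = component lam T k (0, x, y)" using comp[OF k] by simp
    then show ?thesis
      using True entry_mem_entries[of k x y lam S] entry_mem_entries[of k x y lam T]
      by (simp add: b component_apply E rank_eq_iff)
  qed (simp add: is_tableau_outside[OF S] is_tableau_outside[OF T])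
qed

section \<open>Seminormal actions of the symmetric group\<close>

lemma box_of_adj: "box_of (tab_act (adj i) T) e = box_of T (adj i e)"
proof -
  have "adj i m = e \<longleftrightarrow> m = adj i e" for m using adj_adj by metis
  then show ?thesis by (simp add: box_of_def tab_act_def)
qed

lemma comp_of_adj: "comp_of (tab_act (adj i) T) e = comp_of T (adj i e)"
  by (simp add: comp_of_def box_of_adj)

lemma sum_fun_apply: "(\<Sum>x\<in>A. f x) y = (\<Sum>x\<in>A. f x y)"
  by (induction A rule: infinite_finite_induct) auto

lemma sn_vec_in_space: "sn_vec lam T \<in> sn_space lam"
  by (simp add: sn_vec_def sn_space_def)

lemma zero_in_space: "0 \<in> sn_space lam"
  by (simp add: sn_space_def)

lemma add_in_space: "f \<in> sn_space lam \<Longrightarrow> h \<in> sn_space lam \<Longrightarrow> f + h \<in> sn_space lam"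
  by (simp add: sn_space_def)

lemma cscale_in_space: "f \<in> sn_space lam \<Longrightarrow> cscale c f \<in> sn_space lam"
  by (simp add: sn_space_def cscale_def)

lemma sum_in_space: "(\<And>x. x \<in> A \<Longrightarrow> f x \<in> sn_space lam) \<Longrightarrow> (\<Sum>x\<in>A. f x) \<in> sn_space lam"
  by (induction A rule: infinite_finite_induct) (auto simp: zero_in_space add_in_space)

lemma sn_vec_expansion:
  assumes "f \<in> sn_space lam"
  shows "f = (\<Sum>Q\<in>SYT lam. cscale (f Q) (sn_vec lam Q))"
proof
  fix R
  have "(\<Sum>Q\<in>SYT lam. cscale (f Q) (sn_vec lam Q)) R = (\<Sum>Q\<in>SYT lam. if Q = R then f Q else 0)"
    unfolding sum_fun_apply by (rule sum.cong) (auto simp: cscale_def sn_vec_def)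
  then show "f R = (\<Sum>Q\<in>SYT lam. cscale (f Q) (sn_vec lam Q)) R"
    using assms by (simp add: sn_space_def)
qed

text \<open>The common form of \<open>natural_vec\<close> and \<open>sym_natural_vec\<close>.\<close>

definition nat_vec ::
  "nat list list \<Rightarrow> ((nat \<Rightarrow> nat) \<Rightarrow> (tableau \<Rightarrow> complex) \<Rightarrow> (tableau \<Rightarrow> complex)) \<Rightarrow>
   tableau \<Rightarrow> tableau \<Rightarrow> complex" where
  "nat_vec lam act T = act (tab_perm lam T) (sn_vec lam (column_reading lam))"

text \<open>What the module of an r-partition, restricted to the symmetric group, has in common with the
  seminormal modules of single partitions, which are the case of one component.\<close>

locale seminormal_action =
  fixes lam :: "nat list list"
    and act :: "(nat \<Rightarrow> nat) \<Rightarrow> (tableau \<Rightarrow> complex) \<Rightarrow> (tableau \<Rightarrow> complex)"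
  assumes act_closed: "w permutes {1..rsize lam} \<Longrightarrow> f \<in> sn_space lam \<Longrightarrow> act w f \<in> sn_space lam"
    and act_add: "w permutes {1..rsize lam} \<Longrightarrow> f \<in> sn_space lam \<Longrightarrow> h \<in> sn_space lam \<Longrightarrow>
      act w (f + h) = act w f + act w h"
    and act_scale: "w permutes {1..rsize lam} \<Longrightarrow> f \<in> sn_space lam \<Longrightarrow>
      act w (cscale c f) = cscale c (act w f)"
    and act_id: "f \<in> sn_space lam \<Longrightarrow> act id f = f"
    and act_comp: "u permutes {1..rsize lam} \<Longrightarrow> w permutes {1..rsize lam} \<Longrightarrow> f \<in> sn_space lam \<Longrightarrow>
      act (u \<circ> w) f = act u (act w f)"
    and act_adj_sn_vec: "T \<in> SYT lam \<Longrightarrow> 1 \<le> i \<Longrightarrow> i < rsize lam \<Longrightarrow>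
      act (adj i) (sn_vec lam T) = cscale (seminormal_diag T i) (sn_vec lam T)
        + cscale (1 + seminormal_diag T i) (sn_vec lam (tab_act (adj i) T))"
begin

lemma act_zero: "w permutes {1..rsize lam} \<Longrightarrow> act w 0 = 0"
  using act_scale[OF _ zero_in_space, of w 0] by (simp add: cscale_def zero_fun_def)

lemma act_sum:
  "w permutes {1..rsize lam} \<Longrightarrow> (\<And>x. x \<in> A \<Longrightarrow> f x \<in> sn_space lam) \<Longrightarrow>
    act w (\<Sum>x\<in>A. f x) = (\<Sum>x\<in>A. act w (f x))"
  by (induction A rule: infinite_finite_induct) (simp_all add: act_zero act_add sum_in_space)

text \<open>The coefficient of \<open>v\<^sub>R\<close> receives contributions from \<open>v\<^sub>R\<close> and from \<open>v\<^sub>Q\<close> with \<open>s\<^sub>i Q = R\<close> only.  If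
  \<open>s\<^sub>i R\<close> is not standard, the second contribution vanishes because \<open>f\<close> does there.\<close>

lemma act_adj_apply:
  assumes f: "f \<in> sn_space lam" and R: "R \<in> SYT lam" and i: "1 \<le> i" "i < rsize lam"
  shows "act (adj i) f R = seminormal_diag R i * f R
    + (1 + seminormal_diag (tab_act (adj i) R) i) * f (tab_act (adj i) R)"
proof -
  let ?d = "\<lambda>Q. seminormal_diag Q i" and ?sR = "tab_act (adj i) R"
  note p = adj_permutes[OF i]
  have "act (adj i) f = act (adj i) (\<Sum>Q\<in>SYT lam. cscale (f Q) (sn_vec lam Q))"
    using sn_vec_expansion[OF f] by simp
  also have "\<dots> = (\<Sum>Q\<in>SYT lam. cscale (f Q) (cscale (?d Q) (sn_vec lam Q)
      + cscale (1 + ?d Q) (sn_vec lam (tab_act (adj i) Q))))"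
    by (simp add: act_sum[OF p] act_scale[OF p] cscale_in_space sn_vec_in_space
        act_adj_sn_vec[OF _ i] cong: sum.cong_simp)
  finally have "act (adj i) f R = (\<Sum>Q\<in>SYT lam. f Q * (?d Q * sn_vec lam Q R
      + (1 + ?d Q) * sn_vec lam (tab_act (adj i) Q) R))"
    by (simp add: sum_fun_apply cscale_def)
  also have "\<dots> = (\<Sum>Q\<in>SYT lam. (if Q = R then ?d R * f R else 0)
      + (if Q = ?sR then (1 + ?d ?sR) * f ?sR else 0))"
  proof (rule sum.cong[OF refl])
    fix Q assume "Q \<in> SYT lam"
    have "R = tab_act (adj i) Q \<longleftrightarrow> Q = ?sR" by auto
    then have "sn_vec lam (tab_act (adj i) Q) R = (if Q = ?sR then 1 else 0)"
      using R by (auto simp: sn_vec_def)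
    moreover have "sn_vec lam Q R = (if Q = R then 1 else 0)"
      using R by (auto simp: sn_vec_def)
    ultimately show "f Q * (?d Q * sn_vec lam Q R + (1 + ?d Q) * sn_vec lam (tab_act (adj i) Q) R)
      = (if Q = R then ?d R * f R else 0) + (if Q = ?sR then (1 + ?d ?sR) * f ?sR else 0)"
      by (simp add: algebra_simps)
  qed
  also have "\<dots> = ?d R * f R + (1 + ?d ?sR) * f ?sR"
    using R f by (auto simp: sum.distrib sn_space_def)
  finally show ?thesis .
qed

lemma nat_vec_in_space: "is_tableau lam T \<Longrightarrow> nat_vec lam act T \<in> sn_space lam"
  unfolding nat_vec_def using act_closed tab_perm(1) sn_vec_in_space by blast

lemma nat_vec_nonstandard: "is_tableau lam T \<Longrightarrow> R \<notin> SYT lam \<Longrightarrow> nat_vec lam act T R = 0"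
  using nat_vec_in_space[of T] by (simp add: sn_space_def)

lemma nat_vec_column_reading: "nat_vec lam act (column_reading lam) = sn_vec lam (column_reading lam)"
  by (simp add: nat_vec_def tab_perm_column_reading act_id sn_vec_in_space)

lemma nat_vec_adj:
  assumes T: "is_tableau lam T" and i: "1 \<le> i" "i < rsize lam"
  shows "nat_vec lam act (tab_act (adj i) T) = act (adj i) (nat_vec lam act T)"
  unfolding nat_vec_def tab_perm_act[OF adj_permutes[OF i] T]
  by (rule act_comp[OF adj_permutes[OF i] tab_perm(1)[OF T] sn_vec_in_space])

lemma nat_vec_adj_apply:
  assumes "is_tableau lam T" "R \<in> SYT lam" "1 \<le> i" "i < rsize lam"
  shows "nat_vec lam act (tab_act (adj i) T) R = seminormal_diag R i * nat_vec lam act T R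
    + (1 + seminormal_diag (tab_act (adj i) R) i) * nat_vec lam act T (tab_act (adj i) R)"
  unfolding nat_vec_adj[OF assms(1,3,4)]
  by (rule act_adj_apply[OF nat_vec_in_space[OF assms(1)] assms(2-4)])

text \<open>In the inductive step, a tableau \<open>R\<close> that occurs in \<open>s\<^sub>i n\<^sub>S\<close> occurs in \<open>n\<^sub>S\<close>, or \<open>s\<^sub>i R\<close> does.  In
  the second case the lifting property applies to \<open>s\<^sub>i R \<le> S\<close>.\<close>

lemma nat_vec_support:
  assumes "T \<in> SYT lam" "nat_vec lam act T R \<noteq> 0"
  shows "tab_le lam R T"
proof -
  have "\<forall>R. nat_vec lam act T R \<noteq> 0 \<longrightarrow> tab_le lam R T"
    using assms(1)
  proof (induction rule: SYT_induct)
    case column_reading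
    then show ?case
      by (auto simp: nat_vec_column_reading sn_vec_def tab_le_def bruhat_le_refl)
  next
    case (ascent S i)
    let ?n = "rsize lam"
    note tab = SYT_tableau[OF ascent(1)] and p = adj_permutes[OF ascent(2,3)]
    show ?case
    proof (intro allI impI)
      fix R assume nz: "nat_vec lam act (tab_act (adj i) S) R \<noteq> 0"
      have R: "R \<in> SYT lam" using nz nat_vec_nonstandard[OF tab_act_tableau[OF p tab]] by blast
      let ?sR = "tab_act (adj i) R"
      have up: "tab_le lam Q (tab_act (adj i) S)" if "tab_le lam Q S" for Q
        using that ascent(4) bruhat_le_step unfolding tab_le_def by blast
      from nz consider "nat_vec lam act S R \<noteq> 0" | "nat_vec lam act S ?sR \<noteq> 0"
        unfolding nat_vec_adj_apply[OF tab R ascent(2,3)] by fastforce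
      then show "tab_le lam R (tab_act (adj i) S)"
      proof cases
        case 1
        then show ?thesis using ascent(5) up by blast
      next
        case 2
        have sR: "is_tableau lam ?sR" by (rule tab_act_tableau[OF p SYT_tableau[OF R]])
        have le: "bruhat_le ?n (tab_perm lam ?sR) (tab_perm lam S)"
          using 2 ascent(5) by (simp add: tab_le_def)
        have "adj i \<circ> tab_perm lam ?sR = tab_perm lam R"
          using tab_perm_act[OF p sR] by simp
        then have "tab_le lam R S \<or> tab_le lam R (tab_act (adj i) S)"
          using bruhat_le_adj_lift[OF le tab_perm(1)[OF sR] ascent(2,3)] tab_perm_act[OF p tab]
          by (simp add: tab_le_def)
        then show ?thesis using up by blast
      qed
    qed
  qed
  with assms(2) show ?thesis by blast
qed

end

section \<open>Factorization over the components\<close>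

text \<open>Both sides satisfy the same recursion along \<open>SYT_induct\<close>.  The left side obeys \<open>nat_vec_adj_apply\<close>
  for \<open>lam\<close>.  On the right side, exactly one factor changes when \<open>i\<close> and \<open>i + 1\<close> share a component, and
  it obeys the same lemma for the partition of that component; no factor changes when they do not.\<close>

lemma nat_vec_factorization:
  assumes act: "seminormal_action lam act"
    and \<tau>: "\<And>k. k < length lam \<Longrightarrow> seminormal_action [lam ! k] (\<tau> k)"
    and T: "T \<in> SYT lam" and R: "R \<in> SYT lam"
  shows "nat_vec lam act T R = (if alphabet lam R = alphabet lam T
    then \<Prod>k<length lam. nat_vec [lam ! k] (\<tau> k) (component lam T k) (component lam R k) else 0)"
proof -
  interpret seminormal_action lam act by (rule act)
  define A where "A k = (\<lambda>S R. nat_vec [lam ! k] (\<tau> k) (component lam S k) (component lam R k))" for k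
  have "\<forall>R \<in> SYT lam. nat_vec lam act T R =
    (if alphabet lam R = alphabet lam T then \<Prod>k<length lam. A k T R else 0)"
    using T
  proof (induction rule: SYT_induct)
    case column_reading
    let ?C = "column_reading lam"
    show ?case
    proof
      fix R assume R: "R \<in> SYT lam"
      note tab = SYT_tableau[OF R]
      have A: "A k ?C R = (if component lam R k = component lam ?C k then 1 else 0)"
        if k: "k < length lam" for k
      proof -
        interpret k: seminormal_action "[lam ! k]" "\<tau> k" by (rule \<tau>[OF k])
        show ?thesis
          by (simp add: A_def component_column_reading[OF k] k.nat_vec_column_reading
              sn_vec_def column_reading_SYT)
      qed
      show "nat_vec lam act ?C R =
        (if alphabet lam R = alphabet lam ?C then \<Prod>k<length lam. A k ?C R else 0)"
      proof (cases "R = ?C")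
        case True
        then show ?thesis using A by (simp add: nat_vec_column_reading sn_vec_def column_reading_SYT)
      next
        case False
        have "(\<Prod>k<length lam. A k ?C R) = 0" if alph: "alphabet lam R = alphabet lam ?C"
        proof -
          obtain k where "k < length lam" "component lam R k \<noteq> component lam ?C k"
            using tableau_eqI[OF tab column_reading_is_tableau alph] False by blast
          then show ?thesis using A by (auto intro!: prod_zero)
        qed
        then show ?thesis using False by (simp add: nat_vec_column_reading sn_vec_def)
      qed
    qed
  next
    case (ascent S i)
    let ?T = "tab_act (adj i) S"
    note i = ascent(2,3)
    note p = adj_permutes[OF i]
    note S = SYT_tableau[OF ascent(1)]
    \<comment> \<open>The recursion may lead to a nonstandard \<open>s\<^sub>i R\<close>.  The formula still holds there: some component is
      nonstandard, so both sides vanish.\<close>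
    have IH: "nat_vec lam act S Q =
      (if alphabet lam Q = alphabet lam S then \<Prod>k<length lam. A k S Q else 0)"
      if Q: "is_tableau lam Q" for Q
    proof (cases "Q \<in> SYT lam")
      case False
      then obtain k where k: "k < length lam" "component lam Q k \<notin> SYT [lam ! k]"
        using SYT_iff_components[OF Q] by blast
      interpret k: seminormal_action "[lam ! k]" "\<tau> k" by (rule \<tau>[OF k(1)])
      have "A k S Q = 0"
        unfolding A_def using k.nat_vec_nonstandard[OF component_is_tableau[OF S k(1)] k(2)] .
      then have "(\<Prod>k<length lam. A k S Q) = 0" using k(1) by (auto intro!: prod_zero)
      then show ?thesis using nat_vec_nonstandard[OF S False] by simp
    qed (use ascent(5) in blast)
    show ?case
    proof
      fix R assume R': "R \<in> SYT lam"
      let ?sR = "tab_act (adj i) R"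
      note R = SYT_tableau[OF R']
      note sR = tab_act_tableau[OF p R] and tT = tab_act_tableau[OF p S]
      have step: "nat_vec lam act ?T R = seminormal_diag R i * nat_vec lam act S R
        + (1 + seminormal_diag ?sR i) * nat_vec lam act S ?sR"
        by (rule nat_vec_adj_apply[OF S R' i])
      have alph: "alphabet lam ?sR = alphabet lam S \<longleftrightarrow> alphabet lam R = alphabet lam ?T"
        by (rule alphabet_adj_iff)
      show "nat_vec lam act ?T R =
        (if alphabet lam R = alphabet lam ?T then \<Prod>k<length lam. A k ?T R else 0)"
      proof (cases "comp_of R i = comp_of R (Suc i)")
        case False
        \<comment> \<open>Only the term of \<open>s\<^sub>i R\<close> survives, and no relabelled component changes.\<close>
        have d: "seminormal_diag R i = 0" "seminormal_diag ?sR i = 0"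
          using False by (simp_all add: seminormal_diag_def comp_of_adj adj_simps)
        have "A k S ?sR = A k ?T R" if al: "alphabet lam R = alphabet lam ?T" for k
        proof -
          have "\<not> (i \<in> entries lam R k \<and> Suc i \<in> entries lam R k)"
            using False by (auto simp: mem_entries_iff[OF R])
          moreover have "comp_of R i = comp_of S (Suc i)" "comp_of R (Suc i) = comp_of S i"
            using comp_of_cong[OF R tT al, of i] comp_of_cong[OF R tT al, of "Suc i"] i
            by (simp_all add: comp_of_adj adj_simps)
          then have "\<not> (i \<in> entries lam S k \<and> Suc i \<in> entries lam S k)"
            using False by (auto simp: mem_entries_iff[OF S])
          ultimately show ?thesis
            by (simp add: A_def component_adj_separated[OF R i] component_adj_separated[OF S i])
        qed
        then show ?thesis by (simp add: step d IH[OF sR] alph)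
      next
        case True
        have alR: "alphabet lam ?sR = alphabet lam R" by (rule alphabet_adj_joined[OF R i True])
        show ?thesis
        proof (cases "alphabet lam R = alphabet lam ?T")
          case False
          \<comment> \<open>\<open>R\<close> and \<open>s\<^sub>i R\<close> have the same alphabet, which is not that of \<open>S\<close>.\<close>
          then show ?thesis using alR alph by (simp add: step IH[OF sR] IH[OF R])
        next
          case al: True
          then have alS: "alphabet lam R = alphabet lam S" "alphabet lam ?sR = alphabet lam S"
            using alR alph by simp_all
          define m where "m = comp_of R i"
          have m: "m < length lam" unfolding m_def using comp_of_less[OF R] i by simp
          have inR: "i \<in> entries lam R m" "Suc i \<in> entries lam R m"
            using True i by (simp_all add: mem_entries_iff[OF R] m_def)
          have ER: "entries lam R m = entries lam S m" using alS m by (simp add: alphabet_eq_iff)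
          with inR have inS: "i \<in> entries lam S m" "Suc i \<in> entries lam S m" by simp_all
          define j where "j = rank (entries lam R m) i"
          have j: "1 \<le> j" "j < rsize [lam ! m]"
            unfolding j_def by (rule rank_joined_bounds[OF R m inR])+
          have cT: "component lam ?T m = tab_act (adj j) (component lam S m)"
            using component_adj_joined[OF S i inS] by (simp add: j_def ER)
          have csR: "component lam ?sR m = tab_act (adj j) (component lam R m)"
            using component_adj_joined[OF R i inR] by (simp add: j_def)
          have dR: "seminormal_diag (component lam R m) j = seminormal_diag R i"
            unfolding j_def by (rule seminormal_diag_component[OF R m inR])
          have EsR: "entries lam ?sR m = entries lam R m"
            by (simp add: entries_act adj_image_joined inR)
          have dsR: "seminormal_diag (component lam ?sR m) j = seminormal_diag ?sR i"
            unfolding j_def EsR[symmetric]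
            by (rule seminormal_diag_component[OF sR m]) (simp_all add: EsR inR)
          interpret m: seminormal_action "[lam ! m]" "\<tau> m" by (rule \<tau>[OF m])
          have Am: "A m ?T R = seminormal_diag R i * A m S R + (1 + seminormal_diag ?sR i) * A m S ?sR"
          proof -
            have "component lam R m \<in> SYT [lam ! m]" using R' R m SYT_iff_components by blast
            from m.nat_vec_adj_apply[OF component_is_tableau[OF S m] this j]
            show ?thesis unfolding A_def cT csR[symmetric] dR dsR .
          qed
          have Ak: "A k ?T R = A k S R" "A k S ?sR = A k S R" if "k \<noteq> m" for k
          proof -
            have "\<not> (i \<in> entries lam R k \<and> Suc i \<in> entries lam R k)"
              using that by (auto simp: mem_entries_iff[OF R] m_def)
            moreover have "\<not> (i \<in> entries lam S k \<and> Suc i \<in> entries lam S k)"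
              using that inS by (auto simp: mem_entries_iff[OF S])
            ultimately show "A k ?T R = A k S R" "A k S ?sR = A k S R"
              by (simp_all add: A_def component_adj_separated[OF R i] component_adj_separated[OF S i])
          qed
          have split: "(\<Prod>k<length lam. B k) = B m * (\<Prod>k\<in>{..<length lam} - {m}. A k S R)"
            if "\<And>k. k \<noteq> m \<Longrightarrow> B k = A k S R" for B
          proof -
            have "(\<Prod>k<length lam. B k) = B m * (\<Prod>k\<in>{..<length lam} - {m}. B k)"
              using m by (simp add: prod.remove)
            then show ?thesis using that by simp
          qed
          have splits:
            "(\<Prod>k<length lam. A k S R) = A m S R * (\<Prod>k\<in>{..<length lam} - {m}. A k S R)"
            "(\<Prod>k<length lam. A k S ?sR) = A m S ?sR * (\<Prod>k\<in>{..<length lam} - {m}. A k S R)"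
            "(\<Prod>k<length lam. A k ?T R) = A m ?T R * (\<Prod>k\<in>{..<length lam} - {m}. A k S R)"
            using Ak by (auto intro!: split)
          have "nat_vec lam act ?T R = seminormal_diag R i * (\<Prod>k<length lam. A k S R)
              + (1 + seminormal_diag ?sR i) * (\<Prod>k<length lam. A k S ?sR)"
            by (simp add: step IH[OF R] IH[OF sR] alS)
          also have "\<dots> = A m ?T R * (\<Prod>k\<in>{..<length lam} - {m}. A k S R)"
            unfolding splits Am by (simp add: algebra_simps)
          also have "\<dots> = (\<Prod>k<length lam. A k ?T R)"
            by (simp only: splits)
          finally show ?thesis using al by simp
        qed
      qed
    qed
  qed
  with R show ?thesis by (simp add: A_def)
qed

lemma wreath_perm_in_carrier:
  "0 < r \<Longrightarrow> w permutes {1..n} \<Longrightarrow> wreath_perm w \<in> carrier (wreath r n)"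
  by (simp add: wreath_def wreath_perm_def)

lemma wreath_perm_mult: "wreath_perm u \<otimes>\<^bsub>wreath r n\<^esub> wreath_perm w = wreath_perm (u \<circ> w)"
  by (simp add: wreath_def wreath_perm_def)

lemma wreath_perm_one: "wreath_perm id = \<one>\<^bsub>wreath r n\<^esub>"
  by (simp add: wreath_def wreath_perm_def)

lemma seminormal_rep_action:
  assumes "seminormal_rep r \<xi> lam \<rho>" "0 < r"
  shows "seminormal_action lam (\<lambda>w. \<rho> (wreath_perm w))"
proof -
  have rep: "linear_rep (wreath r (rsize lam)) (sn_space lam) \<rho>"
    using assms(1) by (simp add: seminormal_rep_def)
  note car = wreath_perm_in_carrier[OF assms(2)]
  show ?thesis
  proof
    fix T i assume T: "T \<in> SYT lam" "1 \<le> i" "i < rsize lam"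
    then have "\<rho> (wreath_perm (adj i)) (sn_vec lam T) =
        (if comp_of T i \<noteq> comp_of T (Suc i) then sn_vec lam (tab_act (adj i) T)
         else cscale (a_coeff T i) (sn_vec lam T)
              + cscale (1 + a_coeff T i) (sn_vec lam (tab_act (adj i) T)))"
      using assms(1) unfolding seminormal_rep_def by blast
    then show "\<rho> (wreath_perm (adj i)) (sn_vec lam T) =
      cscale (seminormal_diag T i) (sn_vec lam T)
        + cscale (1 + seminormal_diag T i) (sn_vec lam (tab_act (adj i) T))"
      by (auto simp: seminormal_diag_def cscale_def)
  next
    fix u w f assume *: "u permutes {1..rsize lam}" "w permutes {1..rsize lam}" "f \<in> sn_space lam"
    then have "\<rho> (wreath_perm u \<otimes>\<^bsub>wreath r (rsize lam)\<^esub> wreath_perm w) f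
        = \<rho> (wreath_perm u) (\<rho> (wreath_perm w) f)"
      using rep car unfolding linear_rep_def by blast
    then show "\<rho> (wreath_perm (u \<circ> w)) f = \<rho> (wreath_perm u) (\<rho> (wreath_perm w) f)"
      by (simp add: wreath_perm_mult)
  qed (use rep car in \<open>auto simp: linear_rep_def wreath_perm_one[of r "rsize lam"]\<close>)
qed

lemma sym_seminormal_rep_action:
  assumes "sym_seminormal_rep p \<tau>"
  shows "seminormal_action [p] \<tau>"
proof -
  have size: "rsize [p] = sum_list p" by (simp add: rsize_def)
  have rep: "linear_rep (sym_group (sum_list p)) (sn_space [p]) \<tau>"
    using assms by (simp add: sym_seminormal_rep_def)
  show ?thesis
  proof
    fix T i assume T: "T \<in> SYT [p]" "1 \<le> i" "i < rsize [p]"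
    then have "comp_of T i = comp_of T (Suc i)"
      \<comment> \<open>There is just one component.\<close>
      using comp_of_less[OF SYT_tableau[OF T(1)], of i] comp_of_less[OF SYT_tableau[OF T(1)], of "Suc i"]
      by simp
    then show "\<tau> (adj i) (sn_vec [p] T) = cscale (seminormal_diag T i) (sn_vec [p] T)
        + cscale (1 + seminormal_diag T i) (sn_vec [p] (tab_act (adj i) T))"
      using assms T size by (simp add: sym_seminormal_rep_def seminormal_diag_def)
  qed (use rep size in \<open>auto simp: linear_rep_def sym_group_def\<close>)
qed

theorem theorem6p14:
  fixes r n :: nat and \<xi> :: complex and lam :: "nat list list"
    and \<rho> :: "(nat \<Rightarrow> nat) \<times> (nat \<Rightarrow> nat) \<Rightarrow> (tableau \<Rightarrow> complex) \<Rightarrow> (tableau \<Rightarrow> complex)"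
    and \<sigma> :: "nat \<Rightarrow> (nat \<Rightarrow> nat) \<Rightarrow> (tableau \<Rightarrow> complex) \<Rightarrow> (tableau \<Rightarrow> complex)"
    and T :: tableau
  assumes "1 \<le> r"
    and "rpartition r n lam"
    and "primitive_root_of_unity r \<xi>"
    and "seminormal_rep r \<xi> lam \<rho>"
    and "\<And>i. i < r \<Longrightarrow> sym_seminormal_rep (lam ! i) (\<sigma> i)"
    and "T \<in> SYT lam"
  shows "natural_vec \<rho> lam T =
    (\<Sum>S \<in> {S \<in> SYT lam. tab_le lam S T \<and> alphabet lam S = alphabet lam T}.
       cscale (\<Prod>i<r. sym_coeff (\<sigma> i) (lam ! i) (component lam S i) (component lam T i))
         (sn_vec lam S))"
proof
  fix R
  let ?I = "{S \<in> SYT lam. tab_le lam S T \<and> alphabet lam S = alphabet lam T}"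
  let ?act = "\<lambda>w. \<rho> (wreath_perm w)"
  define A where
    "A S = (\<Prod>i<r. sym_coeff (\<sigma> i) (lam ! i) (component lam S i) (component lam T i))" for S
  have r: "length lam = r" using assms(2) by (simp add: rpartition_def)
  interpret seminormal_action lam ?act
    by (rule seminormal_rep_action[OF assms(4)]) (use assms(1) in simp)
  have fact: "nat_vec lam ?act T S = (if alphabet lam S = alphabet lam T then A S else 0)"
    if "S \<in> SYT lam" for S
    using nat_vec_factorization[OF seminormal_action_axioms _ assms(6) that, of \<sigma>]
      sym_seminormal_rep_action[OF assms(5)]
    by (simp add: r A_def sym_coeff_def sym_natural_vec_def nat_vec_def)
  have "nat_vec lam ?act T R = (if R \<in> ?I then A R else 0)"
  proof (cases "R \<in> ?I")
    case True
    then show ?thesis using fact[of R] by simp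
  next
    case False
    have "nat_vec lam ?act T R = 0"
    proof (rule ccontr)
      assume nz: "nat_vec lam ?act T R \<noteq> 0"
      have R: "R \<in> SYT lam" using nz nat_vec_nonstandard[OF SYT_tableau[OF assms(6)]] by blast
      moreover have "tab_le lam R T" by (rule nat_vec_support[OF assms(6) nz])
      moreover have "alphabet lam R = alphabet lam T" using nz unfolding fact[OF R]
        by (rule contrapos_np) simp
      ultimately show False using False by blast
    qed
    then show ?thesis by (simp only: False if_False)
  qed
  moreover have "(\<Sum>S\<in>?I. cscale (A S) (sn_vec lam S)) R = (\<Sum>S\<in>?I. if S = R then A S else 0)"
    unfolding sum_fun_apply by (rule sum.cong) (auto simp: cscale_def sn_vec_def)
  moreover have "finite ?I" by simp
  ultimately show "natural_vec \<rho> lam T R = (\<Sum>S\<in>?I. cscale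
      (\<Prod>i<r. sym_coeff (\<sigma> i) (lam ! i) (component lam S i) (component lam T i)) (sn_vec lam S)) R"
    by (simp add: natural_vec_def nat_vec_def A_def)
qed

end
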